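(* Let $p$ be a prime greater than $7$. Then $$S_{p-1}(1,1,1,4)\equiv S_{p-1}(1,2,2,2)\equiv \frac{27}{16}\,B_{p-7} \pmod{p},$$ $$S_{p-1}(1,1,1,6)\equiv \frac{1}{54}B_{p-3}^3+\frac{1889}{648}\,B_{p-9} \pmod{p}.$$
   Context: For a sequence $(s_1,\dots,s_r)$ of positive integers and an integer $n\ge 0$, $S_n(s_1,\dots,s_r)=\sum_{1\le k_1\le\cdots\le k_r\le n}\frac{1}{k_1^{s_1}\cdots k_r^{s_r}}$. $B_k$ are the Bernoulli numbers defined by $\frac{x}{e^x-1}=\sum_{k\ge0}B_k\frac{x^k}{k!}$. For rational numbers $x,y$, $x\equiv y\pmod{p}$ means that $x-y$ has $p$-adic valuation at least $1$. *)

theory Defs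
  imports "HOL-Computational_Algebra.Computational_Algebra"
begin

definition mult_harm_star_indices :: "nat \<Rightarrow> nat \<Rightarrow> nat list set" where
  "mult_harm_star_indices n r = {ks. length ks = r \<and> sorted ks \<and> set ks \<subseteq> {1..n}}"

text \<open>The list \<open>ks\<close> below is the tuple \<open>k\<^sub>1 \<le> \<dots> \<le> k\<^sub>r\<close>, indexed from \<open>0\<close>.\<close>

definition mult_harm_star :: "nat \<Rightarrow> nat list \<Rightarrow> rat" where
  "mult_harm_star n s =
     (\<Sum>ks\<in>mult_harm_star_indices n (length s). 1 / (\<Prod>i<length s. of_nat (ks ! i) ^ (s ! i)))"

lemma finite_mult_harm_star_indices: "finite (mult_harm_star_indices n r)"
  by (rule finite_subset[OF _ finite_lists_length_eq[of "{1..n}" r]])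
     (auto simp: mult_harm_star_indices_def)

text \<open>
  In the formal power series quotient, numerator and denominator both have subdegree \<open>1\<close>,
  so it is the genuine quotient; see the lemma that follows. In particular \<open>B\<^sub>1 = -1/2\<close>.
\<close>

definition bernoulli_num :: "nat \<Rightarrow> rat" where
  "bernoulli_num k = fact k * fps_nth (fps_X / (fps_exp 1 - 1)) k"

lemma bernoulli_num_egf:
  "Abs_fps (\<lambda>k. bernoulli_num k / fact k) * (fps_exp 1 - 1) = fps_X"
proof -
  have eq: "Abs_fps (\<lambda>k. bernoulli_num k / fact k) = fps_X / (fps_exp 1 - 1)"
    by (rule fps_ext) (simp add: bernoulli_num_def)
  have nz: "fps_exp (1::rat) - 1 \<noteq> 0"
  proof
    assume "fps_exp (1::rat) - 1 = 0"
    then have "fps_nth (fps_exp (1::rat) - 1) 1 = 0" by simp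
    then show False by simp
  qed
  have "subdegree (fps_exp (1::rat) - 1) = 1"
    by (rule subdegreeI) auto
  then have "fps_exp (1::rat) - 1 dvd fps_X"
    using nz by (simp add: fps_dvd_iff)
  then show ?thesis
    unfolding eq by simp
qed

text \<open>Junk value \<open>0\<close> at \<open>x = 0\<close>, where the valuation is \<open>\<infinity>\<close>.\<close>

definition padic_val :: "nat \<Rightarrow> rat \<Rightarrow> int" where
  "padic_val p x =
     int (multiplicity (int p) (fst (quotient_of x))) - int (multiplicity (int p) (snd (quotient_of x)))"

definition rat_cong :: "rat \<Rightarrow> rat \<Rightarrow> nat \<Rightarrow> bool" where
  "rat_cong x y p \<longleftrightarrow> x = y \<or> padic_val p (x - y) \<ge> 1"

end

theory Submission
  imports Defs "HOL-Number_Theory.Residues"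
begin

text \<open>
  Let \<open>H(s\<^sub>1, \<dots>, s\<^sub>r)\<close> be the sum of \<open>1 / (k\<^sub>1^s\<^sub>1 \<cdots> k\<^sub>r^s\<^sub>r)\<close> over \<open>p > k\<^sub>1 > \<cdots> > k\<^sub>r > 0\<close>; its
  depth is \<open>r\<close>, its weight the sum of the entries. A star sum is the sum of \<open>H\<close> over all ways of
  merging neighbouring entries (\<open>mhs_star_eq_coarsenings\<close>), so the theorem is about the values
  modulo \<open>p\<close> of sums \<open>H\<close> of weight 7 and 9. They are found by linear algebra. The relations, for weights
  below \<open>p - 1\<close>, are:

  \<^item> In depth one \<open>H\<close> vanishes. In depth two Faulhaber's formula gives a multiple of
    \<open>B\<^bsub>p-w\<^esub>\<close>, where \<open>w\<close> is the weight (\<open>mhs_depth2\<close>); for even \<open>w\<close> the value is \<open>0\<close>.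
  \<^item> The substitution \<open>k \<mapsto> p - k\<close> gives reversal, \<open>H(s\<^sub>r, \<dots>, s\<^sub>1) \<equiv> (-1)\<^sup>w H(s\<^sub>1, \<dots>, s\<^sub>r)\<close>.
  \<^item> Star sums are the antipode of the sums \<open>H\<close> (\<open>antipode3\<close> and its companions). Together with
    reversal this expresses \<open>2 H(s)\<close> by sums of smaller depth and products whenever depth and
    weight have the same parity.
  \<^item> Since \<open>H(a)\<close> vanishes, so does its stuffle product with any \<open>H(v)\<close>.
  \<^item> The shuffle product of the words of \<open>u\<close> and \<open>v\<close> has the value of a single concatenation
    (\<open>mhs_shuffle\<close>): as power series the multiple polylogarithms multiply by shuffles, and the
    coefficients \<open>m + n < p\<close> of the product become a chain of inequalities under \<open>n \<mapsto> p - n\<close>.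

  By the first three relations, in odd weight every sum of depth at most five is a combination of
  depth-four sums, of \<open>B\<^bsub>p-w\<^esub>\<close>, and in depth five of products of a depth-two and a depth-three
  sum. In weight 7 the stuffle and shuffle relations of total depth four with a factor of depth one
  determine \<open>H(4,1,1,1)\<close> and \<open>H(2,2,2,1)\<close> as multiples of \<open>B\<^bsub>p-7\<^esub>\<close>. In weight 9 one
  shuffle relation of total depth five is added. It contributes \<open>B\<^bsub>p-3\<^esub>\<close> times depth-three sums of weight 6,
  and these are multiples of \<open>B\<^bsub>p-3\<^esub>\<^sup>2\<close> because the antipode in depth four and weight 6 involves
  products of two depth-two sums of weight 3. This is the origin of the cube.
\<close>

section \<open>Congruences modulo p between rational numbers\<close>

locale prime_modulus =
  fixes p :: nat
  assumes prime_p: "prime p"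
begin

text \<open>The local ring \<open>\<int>\<^bsub>(p)\<^esub>\<close>.\<close>

definition pint :: "rat set" where
  "pint = {of_int a / of_int b | a b. \<not> int p dvd b}"

definition rcong :: "rat \<Rightarrow> rat \<Rightarrow> bool" (infix "\<simeq>" 50) where
  "x \<simeq> y \<longleftrightarrow> (\<exists>z\<in>pint. x - y = of_nat p * z)"

lemma prime_int_p: "prime (int p)"
  using prime_p by simp

lemma pint_frac: "\<not> int p dvd b \<Longrightarrow> of_int a / of_int b \<in> pint"
  unfolding pint_def by blast

lemma pint_of_int [simp, intro]: "of_int a \<in> pint"
  using pint_frac[of 1 a] prime_gt_1_nat[OF prime_p] by auto

lemma pint_of_nat [simp, intro]: "of_nat a \<in> pint"
  using pint_of_int[of "int a"] by simp

lemma pint_numeral [simp, intro]: "numeral a \<in> pint"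
  using pint_of_nat[of "numeral a"] by simp

lemma pint_0 [simp, intro]: "0 \<in> pint" and pint_1 [simp, intro]: "1 \<in> pint"
  using pint_of_nat[of 0] pint_of_nat[of 1] by simp_all

lemma pint_mult [intro]:
  assumes "x \<in> pint" "y \<in> pint" shows "x * y \<in> pint"
proof -
  from assms obtain a b c d where *: "\<not> int p dvd b" "\<not> int p dvd d"
    "x = of_int a / of_int b" "y = of_int c / of_int d"
    unfolding pint_def by blast
  have "\<not> int p dvd b * d" using * prime_int_p by (simp add: prime_dvd_mult_iff)
  from pint_frac[OF this, of "a * c"] show ?thesis using * by simp
qed

lemma pint_add [intro]:
  assumes "x \<in> pint" "y \<in> pint" shows "x + y \<in> pint"
proof -
  from assms obtain a b c d where *: "\<not> int p dvd b" "\<not> int p dvd d"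
    "x = of_int a / of_int b" "y = of_int c / of_int d"
    unfolding pint_def by blast
  have nd: "\<not> int p dvd b * d" using * prime_int_p by (simp add: prime_dvd_mult_iff)
  have "b \<noteq> 0" "d \<noteq> 0" using * by auto
  then have "x + y = of_int (a * d + c * b) / of_int (b * d)"
    using * by (simp add: field_simps)
  then show ?thesis using pint_frac[OF nd, of "a * d + c * b"] by simp
qed

lemma pint_uminus [intro]: "x \<in> pint \<Longrightarrow> - x \<in> pint"
  using pint_mult[of "of_int (-1)" x] by (simp del: of_int_minus) (simp add: pint_mult)

lemma pint_diff [intro]: "x \<in> pint \<Longrightarrow> y \<in> pint \<Longrightarrow> x - y \<in> pint"
  using pint_add[of x "- y"] by (simp add: pint_uminus)

lemma pint_sum [intro]: "(\<And>i. i \<in> A \<Longrightarrow> f i \<in> pint) \<Longrightarrow> sum f A \<in> pint"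
  by (induction A rule: infinite_finite_induct) auto

lemma pint_power [intro]: "x \<in> pint \<Longrightarrow> x ^ n \<in> pint"
  by (induction n) auto

lemma pint_sign [simp, intro]: "(- 1) ^ n \<in> pint"
  by (intro pint_power pint_uminus pint_1)

lemma pint_inverse:
  assumes "0 < k" "k < p" shows "1 / of_nat k \<in> pint"
proof -
  have "\<not> int p dvd int k" using assms by (simp add: nat_dvd_not_less)
  from pint_frac[OF this, of 1] show ?thesis by simp
qed

lemma pint_divide: "x \<in> pint \<Longrightarrow> 0 < k \<Longrightarrow> k < p \<Longrightarrow> x / of_nat k \<in> pint"
  using pint_mult[OF _ pint_inverse, of x k] by simp

lemma pint_divide_power:
  assumes "x \<in> pint" "0 < k" "k < p" shows "x / of_nat k ^ s \<in> pint"
  using pint_mult[OF assms(1) pint_power[OF pint_inverse[OF assms(2,3)], of s]]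
  by (simp add: power_divide)

lemma rcong_refl [simp, intro]: "x \<simeq> x"
  unfolding rcong_def by (auto intro!: bexI[of _ 0])

lemma rcong_add [intro]: "x \<simeq> y \<Longrightarrow> x' \<simeq> y' \<Longrightarrow> x + x' \<simeq> y + y'"
  unfolding rcong_def
proof safe
  fix z z' assume *: "x - y = of_nat p * z" "x' - y' = of_nat p * z'" "z \<in> pint" "z' \<in> pint"
  show "\<exists>z\<in>pint. x + x' - (y + y') = of_nat p * z"
    using * by (intro bexI[of _ "z + z'"]) (auto simp: algebra_simps)
qed

lemma rcong_scale: "x \<simeq> y \<Longrightarrow> c \<in> pint \<Longrightarrow> c * x \<simeq> c * y"
  unfolding rcong_def
proof safe
  fix z assume *: "x - y = of_nat p * z" "z \<in> pint" "c \<in> pint"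
  show "\<exists>z\<in>pint. c * x - c * y = of_nat p * z"
  proof (intro bexI[of _ "c * z"])
    have "c * x - c * y = c * (x - y)" by (simp add: algebra_simps)
    then show "c * x - c * y = of_nat p * (c * z)" using * by simp
  qed (use * in auto)
qed

lemma rcong_diff_eq: "x \<simeq> y \<Longrightarrow> x' - y' = x - y \<Longrightarrow> x' \<simeq> y'"
  unfolding rcong_def by simp

lemma rcong_uminus: "x \<simeq> y \<Longrightarrow> - x \<simeq> - y"
  using rcong_scale[of x y "- 1"] by auto

lemma rcong_sym: "x \<simeq> y \<Longrightarrow> y \<simeq> x"
  by (rule rcong_diff_eq[OF rcong_uminus]) auto

lemma rcong_trans [trans]: "x \<simeq> y \<Longrightarrow> y \<simeq> z \<Longrightarrow> x \<simeq> z"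
  by (rule rcong_diff_eq[OF rcong_add[of x y y z]]) auto

lemma rcong_diff: "x \<simeq> y \<Longrightarrow> x' \<simeq> y' \<Longrightarrow> x - x' \<simeq> y - y'"
  using rcong_add[OF _ rcong_uminus] by fastforce

lemma rcong_mult:
  assumes "x \<simeq> y" "x' \<simeq> y'" "x \<in> pint" "y' \<in> pint"
  shows "x * x' \<simeq> y * y'"
proof -
  have "x * x' \<simeq> x * y'" using assms by (intro rcong_scale)
  also have "y' * x \<simeq> y' * y" using assms by (intro rcong_scale)
  then have "x * y' \<simeq> y * y'" by (simp add: mult.commute)
  finally show ?thesis .
qed

lemma rcong_sum: "(\<And>i. i \<in> A \<Longrightarrow> f i \<simeq> g i) \<Longrightarrow> sum f A \<simeq> sum g A"
  by (induction A rule: infinite_finite_induct) auto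

lemma rcong_sum_list: "(\<And>i. i \<in> set xs \<Longrightarrow> f i \<simeq> g i) \<Longrightarrow> sum_list (map f xs) \<simeq> sum_list (map g xs)"
  by (induction xs) auto

lemma pint_rcong: "x \<simeq> y \<Longrightarrow> y \<in> pint \<Longrightarrow> x \<in> pint"
proof -
  assume "x \<simeq> y" "y \<in> pint"
  then obtain z where z: "x - y = of_nat p * z" "z \<in> pint" unfolding rcong_def by blast
  have "x = y + of_nat p * z" using z by simp
  moreover have "y + of_nat p * z \<in> pint" using \<open>y \<in> pint\<close> z by auto
  ultimately show ?thesis by simp
qed

lemma rcong_power: "x \<simeq> y \<Longrightarrow> y \<in> pint \<Longrightarrow> x ^ n \<simeq> y ^ n"
  by (induction n) (auto intro!: rcong_mult intro: pint_rcong)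

lemma rcong_p_mult: "x \<in> pint \<Longrightarrow> of_nat p * x \<simeq> 0"
  unfolding rcong_def by auto

lemma rcong_prod:
  "(\<And>i. i \<in> A \<Longrightarrow> f i \<simeq> g i) \<Longrightarrow> (\<And>i. i \<in> A \<Longrightarrow> g i \<in> pint) \<Longrightarrow>
     prod f A \<simeq> prod g A \<and> prod g A \<in> pint"
  by (induction A rule: infinite_finite_induct) (auto intro!: rcong_mult intro: pint_rcong)

lemma rat_congI:
  assumes "x \<simeq> y" shows "rat_cong x y p"
proof (cases "x = y")
  case False
  from assms obtain a b where ab: "\<not> int p dvd b" "x - y = of_nat p * (of_int a / of_int b)"
    unfolding rcong_def pint_def by blast
  obtain m n where q: "quotient_of (x - y) = (m, n)" by fastforce
  have n: "n > 0" and cop: "coprime m n" and eq: "x - y = of_int m / of_int n"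
    using q quotient_of_denom_pos quotient_of_coprime quotient_of_div by blast+
  have "b \<noteq> 0" using ab by auto
  have "of_int m * of_int b = (of_int (int p * a * n) :: rat)"
    using ab(2) eq n \<open>b \<noteq> 0\<close> by (simp add: field_simps)
  then have e: "m * b = int p * a * n" by (simp only: of_int_mult[symmetric] of_int_eq_iff)
  then have "int p dvd m * b" by simp
  then have pm: "int p dvd m" using ab(1) prime_int_p prime_dvd_mult_iff by blast
  then have "\<not> int p dvd n" using cop prime_int_p
    by (meson coprime_common_divisor not_prime_unit)
  then have "multiplicity (int p) n = 0" by (rule not_dvd_imp_multiplicity_0)
  moreover have "m \<noteq> 0" using False eq by auto
  then have "multiplicity (int p) m \<ge> 1"
    using pm prime_int_p by (intro multiplicity_geI) auto
  ultimately show ?thesis unfolding rat_cong_def padic_val_def by (simp add: q)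
qed (simp add: rat_cong_def)

end

section \<open>Multiple harmonic sums: stuffle product and star sums\<close>

text \<open>
  The first entry belongs to the largest summation index. In this order prepending an entry is
  prepending a block of letters to the word of the index, which is what the shuffle recursion needs.
\<close>

primrec mhs :: "nat list \<Rightarrow> nat \<Rightarrow> rat" where
  "mhs [] n = 1"
| "mhs (s # ss) n = (\<Sum>k=1..n. mhs ss (k - 1) / of_nat k ^ s)"

primrec mhs_star :: "nat list \<Rightarrow> nat \<Rightarrow> rat" where
  "mhs_star [] n = 1"
| "mhs_star (s # ss) n = (\<Sum>k=1..n. mhs_star ss k / of_nat k ^ s)"

text \<open>The tuples of the star sum are increasing, so its last exponent belongs to the largest index.\<close>

lemma mult_harm_star_snoc:
  "mult_harm_star n (s @ [a]) = (\<Sum>k=1..n. mult_harm_star k s / of_nat k ^ a)"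
proof -
  let ?g = "\<lambda>ks. 1 / (\<Prod>i<length (s @ [a]). of_nat (ks ! i) ^ ((s @ [a]) ! i)) :: rat"
  have "mult_harm_star n (s @ [a]) = sum ?g (mult_harm_star_indices n (Suc (length s)))"
    by (simp add: mult_harm_star_def)
  also have "\<dots> = (\<Sum>(k, ks)\<in>(SIGMA k:{1..n}. mult_harm_star_indices k (length s)). ?g (ks @ [k]))"
  proof (rule sum.reindex_bij_witness[where
        j = "\<lambda>ks. (last ks, butlast ks)" and i = "\<lambda>(k, ks). ks @ [k]"])
    fix ks assume "ks \<in> mult_harm_star_indices n (Suc (length s))"
    then have ks: "length ks = Suc (length s)" "sorted ks" "set ks \<subseteq> {1..n}"
      by (auto simp: mult_harm_star_indices_def)
    then have "ks \<noteq> []" by auto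
    then obtain xs x where xs: "ks = xs @ [x]" by (metis rev_exhaust)
    show "(case (last ks, butlast ks) of (k, ks) \<Rightarrow> ks @ [k]) = ks" using xs by simp
    show "(last ks, butlast ks) \<in> (SIGMA k:{1..n}. mult_harm_star_indices k (length s))"
      using ks unfolding xs by (force simp: mult_harm_star_indices_def sorted_append)
    show "(case (last ks, butlast ks) of (k, ks) \<Rightarrow> ?g (ks @ [k])) = ?g ks" using xs by simp
  next
    fix b assume "b \<in> (SIGMA k:{1..n}. mult_harm_star_indices k (length s))"
    then obtain k ks where b: "b = (k, ks)" "k \<in> {1..n}" "length ks = length s" "sorted ks" "set ks \<subseteq> {1..k}"
      by (auto simp: mult_harm_star_indices_def)
    show "(\<lambda>ks. (last ks, butlast ks)) (case b of (k, ks) \<Rightarrow> ks @ [k]) = b" using b by simp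
    show "(case b of (k, ks) \<Rightarrow> ks @ [k]) \<in> mult_harm_star_indices n (Suc (length s))"
      using b by (force simp: mult_harm_star_indices_def sorted_append)
  qed
  also have "\<dots> = (\<Sum>k=1..n. \<Sum>ks\<in>mult_harm_star_indices k (length s). ?g (ks @ [k]))"
    by (subst sum.Sigma) (auto simp: finite_mult_harm_star_indices)
  also have "\<dots> = (\<Sum>k=1..n. mult_harm_star k s / of_nat k ^ a)"
    unfolding mult_harm_star_def sum_divide_distrib
  proof (intro sum.cong refl)
    fix k ks assume "ks \<in> mult_harm_star_indices k (length s)"
    then have l: "length ks = length s" by (simp add: mult_harm_star_indices_def)
    have "(\<Prod>i<length s. (of_nat ((ks @ [k]) ! i) :: rat) ^ ((s @ [a]) ! i))
      = (\<Prod>i<length s. of_nat (ks ! i) ^ (s ! i))"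
      by (intro prod.cong) (auto simp: nth_append l)
    then show "?g (ks @ [k]) = 1 / (\<Prod>i<length s. of_nat (ks ! i) ^ (s ! i)) / of_nat k ^ a"
      by (simp add: nth_append l)
  qed
  finally show ?thesis .
qed

lemma mult_harm_star_eq_mhs_star: "mult_harm_star n s = mhs_star (rev s) n"
proof (induction s arbitrary: n rule: rev_induct)
  case Nil
  have "mult_harm_star_indices n 0 = {[]}" by (auto simp: mult_harm_star_indices_def)
  then show ?case by (simp add: mult_harm_star_def)
next
  case (snoc a s)
  then show ?case by (simp add: mult_harm_star_snoc)
qed

text \<open>All lists that arise by replacing some commas by plus signs.\<close>

primrec coarsenings :: "nat list \<Rightarrow> nat list list" where
  "coarsenings [] = [[]]"
| "coarsenings (s # ss) =
     (if ss = [] then [[s]]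
      else concat (map (\<lambda>c. [s # c, (s + hd c) # tl c]) (coarsenings ss)))"

lemma coarsenings_nonempty: "ss \<noteq> [] \<Longrightarrow> c \<in> set (coarsenings ss) \<Longrightarrow> c \<noteq> []"
  by (cases ss) (auto split: if_splits)

lemma sum_list_sum_swap:
  "(\<Sum>k\<in>A. \<Sum>c\<leftarrow>cs. f k c) = (\<Sum>c\<leftarrow>cs. \<Sum>k\<in>A. (f k c :: 'a :: comm_monoid_add))"
  by (induction cs) (simp_all add: sum.distrib)

lemma mhs_Suc: "mhs (s # ss) (Suc n) = mhs (s # ss) n + mhs ss n / of_nat (Suc n) ^ s"
  by simp

text \<open>
  Each weak inequality between neighbouring indices is either strict or an equality, and equal
  indices add their exponents.
\<close>

lemma mhs_star_eq_coarsenings: "mhs_star s n = (\<Sum>c\<leftarrow>coarsenings s. mhs c n)"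
proof (induction s arbitrary: n)
  case (Cons s ss)
  show ?case
  proof (cases "ss = []")
    case False
    have step: "mhs c k / of_nat k ^ s = mhs c (k - 1) / of_nat k ^ s + mhs (tl c) (k - 1) / of_nat k ^ (s + hd c)"
      if ck: "c \<in> set (coarsenings ss)" "k \<in> {1..n}" for c k
    proof -
      obtain t c' where c: "c = t # c'" using coarsenings_nonempty[OF False ck(1)] by (cases c) auto
      obtain j where "k = Suc j" using ck(2) by (cases k) auto
      then show ?thesis using mhs_Suc[of t c' j] by (simp add: c add_divide_distrib power_add mult.commute)
    qed
    have "mhs_star (s # ss) n = (\<Sum>k=1..n. \<Sum>c\<leftarrow>coarsenings ss. mhs c k / of_nat k ^ s)"
      by (simp add: Cons.IH divide_inverse sum_list_mult_const)
    also have "\<dots> = (\<Sum>c\<leftarrow>coarsenings ss. \<Sum>k=1..n. mhs c k / of_nat k ^ s)"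
      by (rule sum_list_sum_swap)
    also have "\<dots> = (\<Sum>c\<leftarrow>coarsenings ss. mhs (s # c) n + mhs ((s + hd c) # tl c) n)"
      by (intro arg_cong[where f = sum_list] map_cong refl)
         (simp add: step sum.distrib[symmetric])
    also have "\<dots> = (\<Sum>c\<leftarrow>coarsenings (s # ss). mhs c n)"
    proof -
      have "(\<Sum>c\<leftarrow>concat (map (\<lambda>c. [s # c, (s + hd c) # tl c]) cs). mhs c n)
        = (\<Sum>c\<leftarrow>cs. mhs (s # c) n + mhs ((s + hd c) # tl c) n)" for cs
        by (induction cs) (simp_all add: add.assoc)
      then show ?thesis using False by simp
    qed
    finally show ?thesis .
  qed simp
qed simp

fun stuffle :: "nat list \<Rightarrow> nat list \<Rightarrow> nat list list" where
  "stuffle [] v = [v]"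
| "stuffle u [] = [u]"
| "stuffle (a # u) (b # v) =
     map ((#) a) (stuffle u (b # v)) @ map ((#) b) (stuffle (a # u) v) @ map ((#) (a + b)) (stuffle u v)"

lemma sum_mult_sum_less:
  fixes f g :: "nat \<Rightarrow> rat"
  shows "(\<Sum>k=1..n. f k) * (\<Sum>k=1..n. g k) =
    (\<Sum>k=1..n. f k * (\<Sum>j=1..k - 1. g j)) + (\<Sum>k=1..n. g k * (\<Sum>j=1..k - 1. f j)) + (\<Sum>k=1..n. f k * g k)"
  by (induction n) (simp_all add: algebra_simps)

lemma mhs_Cons_list:
  "(\<Sum>w\<leftarrow>map ((#) a) ws. mhs w n) = (\<Sum>k=1..n. (\<Sum>w\<leftarrow>ws. mhs w (k - 1)) / of_nat k ^ a)"
proof -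
  have "(\<Sum>w\<leftarrow>map ((#) a) ws. mhs w n) = (\<Sum>w\<leftarrow>ws. \<Sum>k=1..n. mhs w (k - 1) / of_nat k ^ a)"
    by (simp add: comp_def)
  also have "\<dots> = (\<Sum>k=1..n. \<Sum>w\<leftarrow>ws. mhs w (k - 1) / of_nat k ^ a)"
    by (rule sum_list_sum_swap[symmetric])
  finally show ?thesis by (simp add: divide_inverse sum_list_mult_const)
qed

text \<open>
  The three summands of the recursion correspond to the largest index of the first factor being
  larger than, smaller than or equal to that of the second.
\<close>

lemma mhs_stuffle: "mhs u n * mhs v n = (\<Sum>w\<leftarrow>stuffle u v. mhs w n)"
proof (induction u v arbitrary: n rule: stuffle.induct)
  case (3 a u b v)
  have "mhs (a # u) n * mhs (b # v) n =
      (\<Sum>k=1..n. mhs u (k - 1) / of_nat k ^ a * mhs (b # v) (k - 1))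
    + (\<Sum>k=1..n. mhs v (k - 1) / of_nat k ^ b * mhs (a # u) (k - 1))
    + (\<Sum>k=1..n. (mhs u (k - 1) / of_nat k ^ a) * (mhs v (k - 1) / of_nat k ^ b))"
    unfolding mhs.simps by (rule sum_mult_sum_less)
  also have "\<dots> = (\<Sum>k=1..n. (mhs u (k - 1) * mhs (b # v) (k - 1)) / of_nat k ^ a)
    + (\<Sum>k=1..n. (mhs (a # u) (k - 1) * mhs v (k - 1)) / of_nat k ^ b)
    + (\<Sum>k=1..n. (mhs u (k - 1) * mhs v (k - 1)) / of_nat k ^ (a + b))"
    by (intro arg_cong2[where f = "(+)"] sum.cong refl) (simp_all add: power_add del: mhs.simps)
  also have "\<dots> = (\<Sum>w\<leftarrow>stuffle (a # u) (b # v). mhs w n)"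
    unfolding 3 stuffle.simps map_append sum_list_append mhs_Cons_list by (simp only: add.assoc)
  finally show ?case .
qed simp_all

text \<open>
  A sum over sequences that increase weakly up to a distinguished index \<open>k\<close> and then decrease
  strictly. The weakly increasing part is recorded in \<open>u\<close>, again starting next to \<open>k\<close>.
\<close>

definition mhs_pivot :: "nat list \<Rightarrow> nat \<Rightarrow> nat list \<Rightarrow> nat \<Rightarrow> rat" where
  "mhs_pivot u s v n = (\<Sum>k=1..n. mhs_star u k * mhs v (k - 1) / of_nat k ^ s)"

lemma sum_mult_sum_le:
  fixes f g :: "nat \<Rightarrow> rat"
  shows "(\<Sum>k=1..n. f k) * (\<Sum>k=1..n. g k) =
    (\<Sum>k=1..n. f k * (\<Sum>j=1..k - 1. g j)) + (\<Sum>k=1..n. g k * (\<Sum>j=1..k. f j))"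
  by (induction n) (simp_all add: algebra_simps)

text \<open>
  The larger of the two leading indices becomes the peak; in the case of equality it is the one of
  the strict sum. In the alternating sum over all ways to cut an index into an initial and a final
  part every peaked sum occurs twice with opposite signs, whence the antipode relations.
\<close>

lemma mhs_star_mult_mhs:
  "mhs_star (s # u) n * mhs (t # v) n = mhs_pivot u s (t # v) n + mhs_pivot (s # u) t v n"
  unfolding mhs_pivot_def mhs.simps mhs_star.simps sum_mult_sum_le by (simp add: mult.commute)

lemma mhs_eq_pivot: "mhs (s # u) n = mhs_pivot [] s u n"
  and mhs_star_eq_pivot: "mhs_star (s # u) n = mhs_pivot u s [] n"
  by (simp_all add: mhs_pivot_def)

lemma antipode3:
  "mhs_star [c, b, a] n = mhs [a, b, c] n - mhs_star [a] n * mhs [b, c] n + mhs_star [b, a] n * mhs [c] n"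
  unfolding mhs_star_mult_mhs mhs_eq_pivot[of a] mhs_star_eq_pivot[of c] by simp

lemma antipode4:
  "mhs_star [d, c, b, a] n = - mhs [a, b, c, d] n + mhs_star [a] n * mhs [b, c, d] n
     - mhs_star [b, a] n * mhs [c, d] n + mhs_star [c, b, a] n * mhs [d] n"
  unfolding mhs_star_mult_mhs mhs_eq_pivot[of a] mhs_star_eq_pivot[of d] by simp

lemma antipode5:
  "mhs_star [e, d, c, b, a] n = mhs [a, b, c, d, e] n - mhs_star [a] n * mhs [b, c, d, e] n
     + mhs_star [b, a] n * mhs [c, d, e] n - mhs_star [c, b, a] n * mhs [d, e] n
     + mhs_star [d, c, b, a] n * mhs [e] n"
  unfolding mhs_star_mult_mhs mhs_eq_pivot[of a] mhs_star_eq_pivot[of e] by simp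

section \<open>The shuffle relation modulo p\<close>

text \<open>
  Words in two letters encode iterated integrals: \<open>True\<close> stands for \<open>dt / (1 - t)\<close> and \<open>False\<close> for
  \<open>dt / t\<close>, and the head of the list is the outermost integration. An entry \<open>s\<close> is the block
  \<open>False\<^sup>s\<^sup>-\<^sup>1 True\<close>. Multiplicities matter, so the shuffles form a list.
\<close>

fun shuffle :: "bool list \<Rightarrow> bool list \<Rightarrow> bool list list" where
  "shuffle [] v = [v]"
| "shuffle u [] = [u]"
| "shuffle (a # u) (b # v) = map ((#) a) (shuffle u (b # v)) @ map ((#) b) (shuffle (a # u) v)"

primrec word :: "nat list \<Rightarrow> bool list" where
  "word [] = []"
| "word (s # ss) = replicate (s - 1) False @ True # word ss"

text \<open>
  Only meaningful for words that end in \<open>True\<close> (and the empty word); otherwise \<open>hd []\<close> occurs.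
\<close>

primrec index_of_word :: "bool list \<Rightarrow> nat list" where
  "index_of_word [] = []"
| "index_of_word (a # w) =
     (if a then 1 # index_of_word w
      else Suc (hd (index_of_word w)) # tl (index_of_word w))"

definition admissible :: "bool list \<Rightarrow> bool" where
  "admissible w \<longleftrightarrow> w = [] \<or> last w"

text \<open>The part of the multiple harmonic sum whose largest index is exactly \<open>n\<close>.\<close>

fun mhs_top :: "nat list \<Rightarrow> nat \<Rightarrow> rat" where
  "mhs_top [] n = (if n = 0 then 1 else 0)"
| "mhs_top (s # ss) n = (if n = 0 then 0 else mhs ss (n - 1) / of_nat n ^ s)"

lemma sum_mhs_top: "(\<Sum>m\<le>n. mhs_top s m) = mhs s n"
  by (cases s; induction n) simp_all

lemma index_of_word_word: "0 \<notin> set s \<Longrightarrow> index_of_word (word s) = s"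
proof (induction s)
  case (Cons a s)
  have "index_of_word (replicate m False @ True # word s) = Suc m # s" for m
    using Cons by (induction m) auto
  from this[of "a - 1"] Cons.prems show ?case by simp
qed simp

lemma admissible_word: "admissible (word s)"
  by (induction s) (auto simp: admissible_def)

lemma shuffle_Nil2 [simp]: "shuffle u [] = [u]"
  by (cases u) auto

lemma admissible_shuffle:
  "admissible u \<Longrightarrow> admissible v \<Longrightarrow> w \<in> set (shuffle u v) \<Longrightarrow>
     admissible w \<and> (w = [] \<longleftrightarrow> u = [] \<and> v = [])"
proof (induction u v arbitrary: w rule: shuffle.induct)
  case (3 a u b v)
  have tl: "admissible u" "admissible v"
    using "3.prems" by (auto simp: admissible_def split: if_splits)
  from "3.prems"(3) consider x where "w = a # x" "x \<in> set (shuffle u (b # v))"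
    | x where "w = b # x" "x \<in> set (shuffle (a # u) v)"
    by auto
  then show ?case
  proof cases
    case 1
    with "3.IH"(1)[OF tl(1) "3.prems"(2) 1(2)] show ?thesis by (auto simp: admissible_def)
  next
    case 2
    with "3.IH"(2)[OF "3.prems"(1) tl(2) 2(2)] show ?thesis by (auto simp: admissible_def)
  qed
qed auto

text \<open>The Taylor series at \<open>0\<close> of the multiple polylogarithm.\<close>

definition polylog :: "bool list \<Rightarrow> rat fps" where
  "polylog w = Abs_fps (mhs_top (index_of_word w))"

text \<open>The operator \<open>t d/dt\<close>, and below it \<open>t / (1 - t)\<close>.\<close>

definition euler :: "rat fps \<Rightarrow> rat fps" where
  "euler f = fps_X * fps_deriv f"

definition geom :: "rat fps" where
  "geom = Abs_fps (\<lambda>n. if n = 0 then 0 else 1)"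

lemma euler_nth: "euler f $ n = of_nat n * f $ n"
  by (cases n) (simp_all add: euler_def)

lemma euler_mult: "euler (f * g) = euler f * g + f * euler g"
  by (simp add: euler_def algebra_simps)

lemma euler_add: "euler (f + g) = euler f + euler g"
  by (simp add: euler_def algebra_simps)

lemma euler_sum_list: "euler (\<Sum>x\<leftarrow>xs. f x) = (\<Sum>x\<leftarrow>xs. euler (f x))"
  by (induction xs) (simp_all add: euler_def algebra_simps)

lemma euler_inject:
  assumes "euler f = euler g" "f $ 0 = g $ 0" shows "f = g"
proof (rule fps_ext)
  fix n show "f $ n = g $ n"
    using assms euler_nth[of f n] euler_nth[of g n] by (cases "n = 0") auto
qed

lemma geom_mult_nth: "(geom * f) $ n = (\<Sum>m<n. f $ m)"
proof -
  have "(f * geom) $ n = (\<Sum>m=0..n. f $ m * (if n - m = 0 then 0 else 1))"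
    by (simp add: fps_mult_nth geom_def)
  also have "\<dots> = (\<Sum>m<n. f $ m)"
    by (intro sum.mono_neutral_cong_right) auto
  finally show ?thesis by (simp add: mult.commute)
qed

definition integrand :: "bool \<Rightarrow> rat fps" where
  "integrand a = (if a then geom else 1)"

lemma index_of_word_nonempty: "w \<noteq> [] \<Longrightarrow> index_of_word w \<noteq> []"
  by (cases w) auto

lemma polylog_Nil: "polylog [] = 1"
  by (rule fps_ext) (simp add: polylog_def)

lemma polylog_nth_0: "w \<noteq> [] \<Longrightarrow> polylog w $ 0 = 0"
  using index_of_word_nonempty[of w] by (cases "index_of_word w") (auto simp: polylog_def)

text \<open>
  Differentiating an iterated integral removes the outermost integration. Words that end in
  \<open>False\<close> are excluded because their integrals involve the logarithm, which has no Taylor series at \<open>0\<close>.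
\<close>

lemma euler_polylog:
  assumes "admissible (a # w)"
  shows "euler (polylog (a # w)) = integrand a * polylog w"
proof (rule fps_ext)
  fix n
  show "euler (polylog (a # w)) $ n = (integrand a * polylog w) $ n"
  proof (cases a)
    case True
    have "(\<Sum>m<n. polylog w $ m) = mhs (index_of_word w) (n - 1)" if "n > 0"
    proof -
      have "{..<n} = {..n - 1}" using that by auto
      then show ?thesis by (simp add: polylog_def sum_mhs_top)
    qed
    then show ?thesis using True
      by (cases "n = 0") (simp_all add: euler_nth integrand_def geom_mult_nth, simp_all add: polylog_def geom_def)
  next
    case False
    then have "w \<noteq> []" using assms by (auto simp: admissible_def)
    then obtain s ss where "index_of_word w = s # ss"
      using index_of_word_nonempty by (cases "index_of_word w") auto
    then show ?thesis using False
      by (simp add: euler_nth integrand_def polylog_def)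
  qed
qed

text \<open>
  By the Leibniz rule both sides satisfy the same differential equation and the shuffle recursion is
  exactly that equation; the constant terms vanish unless both words are empty.
\<close>

lemma polylog_shuffle:
  "admissible u \<Longrightarrow> admissible v \<Longrightarrow>
     polylog u * polylog v = (\<Sum>w\<leftarrow>shuffle u v. polylog w)"
proof (induction u v rule: shuffle.induct)
  case (3 a u b v)
  have tl: "admissible u" "admissible v"
    using "3.prems" by (auto simp: admissible_def split: if_splits)
  note IH = "3.IH"(1)[OF tl(1) "3.prems"(2)] "3.IH"(2)[OF "3.prems"(1) tl(2)]
  have eul: "(\<Sum>w\<leftarrow>map ((#) c) ws. euler (polylog w)) = integrand c * (\<Sum>w\<leftarrow>ws. polylog w)"
    if "\<And>w. w \<in> set ws \<Longrightarrow> admissible (c # w)" for c ws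
    using that by (induction ws) (simp_all add: euler_polylog algebra_simps)
  have adm: "admissible w" "w \<noteq> []" if "w \<in> set (shuffle (a # u) (b # v))" for w
    using admissible_shuffle[OF "3.prems" that] by auto
  show ?case
  proof (rule euler_inject)
    have "euler (polylog (a # u) * polylog (b # v))
      = integrand a * (polylog u * polylog (b # v)) + integrand b * (polylog (a # u) * polylog v)"
      using "3.prems" by (simp add: euler_mult euler_polylog algebra_simps)
    also have "\<dots> = (\<Sum>w\<leftarrow>map ((#) a) (shuffle u (b # v)). euler (polylog w))
        + (\<Sum>w\<leftarrow>map ((#) b) (shuffle (a # u) v). euler (polylog w))"
      unfolding IH using adm by (intro arg_cong2[where f = "(+)"] eul[symmetric]) auto
    also have "\<dots> = euler (\<Sum>w\<leftarrow>shuffle (a # u) (b # v). polylog w)"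
      by (simp add: euler_add euler_sum_list comp_def)
    finally show "euler (polylog (a # u) * polylog (b # v)) =
      euler (\<Sum>w\<leftarrow>shuffle (a # u) (b # v). polylog w)" .
    have "(\<Sum>w\<leftarrow>ws. polylog w) $ 0 = 0" if "\<And>w. w \<in> set ws \<Longrightarrow> w \<noteq> []" for ws
      using that by (induction ws) (auto simp: polylog_nth_0)
    then show "(polylog (a # u) * polylog (b # v)) $ 0 = (\<Sum>w\<leftarrow>shuffle (a # u) (b # v). polylog w) $ 0"
      using adm by (simp add: polylog_nth_0 del: shuffle.simps)
  qed
qed (simp_all add: polylog_Nil)

lemma mhs_shuffle_convolution:
  assumes "0 \<notin> set u" "0 \<notin> set v"
  shows "(\<Sum>w\<leftarrow>shuffle (word u) (word v). mhs (index_of_word w) n)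
       = (\<Sum>m\<le>n. mhs_top u m * mhs v (n - m))"
proof -
  have nth: "(\<Sum>w\<leftarrow>ws. polylog w) $ N = (\<Sum>w\<leftarrow>ws. polylog w $ N)" for ws N
    by (induction ws) auto
  have "(\<Sum>w\<leftarrow>shuffle (word u) (word v). mhs (index_of_word w) n)
      = (\<Sum>w\<leftarrow>shuffle (word u) (word v). \<Sum>N\<le>n. polylog w $ N)"
    by (simp add: polylog_def sum_mhs_top)
  also have "\<dots> = (\<Sum>N\<le>n. (polylog (word u) * polylog (word v)) $ N)"
    by (simp add: polylog_shuffle admissible_word nth sum_list_sum_swap)
  also have "\<dots> = (\<Sum>N\<le>n. \<Sum>m\<le>N. mhs_top u m * mhs_top v (N - m))"
    using assms by (simp add: fps_mult_nth polylog_def index_of_word_word atLeast0AtMost)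
  also have "\<dots> = (\<Sum>m\<le>n. \<Sum>l\<le>n - m. mhs_top u m * mhs_top v l)"
    unfolding sum.Sigma[OF finite_atMost ballI[OF finite_atMost]]
    by (rule sum.reindex_bij_witness[where i = "\<lambda>(m, l). (m + l, m)" and j = "\<lambda>(N, m). (m, N - m)"]) auto
  also have "\<dots> = (\<Sum>m\<le>n. mhs_top u m * mhs v (n - m))"
    by (simp add: sum_distrib_left[symmetric] sum_mhs_top)
  finally show ?thesis .
qed

text \<open>
  The mirror image of \<open>mhs\<close>: sums over \<open>m < k\<^sub>1 < \<cdots> < k\<^sub>r \<le> n\<close>, where the first entry belongs to the
  smallest index. The substitution \<open>k \<mapsto> p - k\<close> exchanges the two.
\<close>

primrec mhs_above :: "nat list \<Rightarrow> nat \<Rightarrow> nat \<Rightarrow> rat" where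
  "mhs_above [] m n = 1"
| "mhs_above (s # ss) m n = (\<Sum>k\<in>{m<..n}. mhs_above ss k n / of_nat k ^ s)"

text \<open>A chain is cut at the index \<open>m\<close> that carries the first entry of \<open>u\<close>.\<close>

lemma splice: "(\<Sum>m\<le>n. mhs_top u m * mhs_above v m n) = mhs (rev v @ u) n"
proof (induction v arbitrary: u)
  case Nil
  then show ?case by (simp add: sum_mhs_top)
next
  case (Cons t v)
  have "(\<Sum>m\<le>n. mhs_top u m * mhs_above (t # v) m n)
    = (\<Sum>m\<le>n. \<Sum>k\<in>{m<..n}. mhs_top u m * mhs_above v k n / of_nat k ^ t)"
    by (simp add: sum_distrib_left)
  also have "\<dots> = (\<Sum>k\<in>{1..n}. \<Sum>m<k. mhs_top u m * mhs_above v k n / of_nat k ^ t)"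
    unfolding sum.Sigma[OF finite_atMost ballI[OF finite_greaterThanAtMost]]
      sum.Sigma[OF finite_atLeastAtMost ballI[OF finite_lessThan]]
    by (rule sum.reindex_bij_witness[where i = "\<lambda>(x, y). (y, x)" and j = "\<lambda>(x, y). (y, x)"]) auto
  also have "\<dots> = (\<Sum>k=1..n. mhs_top (t # u) k * mhs_above v k n)"
  proof (intro sum.cong refl)
    fix k assume k: "k \<in> {1..n}"
    then have "{..<k} = {..k - 1}" by auto
    then have "(\<Sum>m<k. mhs_top u m) = mhs u (k - 1)" by (simp add: sum_mhs_top)
    then show "(\<Sum>m<k. mhs_top u m * mhs_above v k n / of_nat k ^ t) = mhs_top (t # u) k * mhs_above v k n"
      using k by (simp add: sum_divide_distrib[symmetric] sum_distrib_right[symmetric])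
  qed
  also have "\<dots> = (\<Sum>k\<le>n. mhs_top (t # u) k * mhs_above v k n)"
    by (intro sum.mono_neutral_left) auto
  finally show ?case using Cons.IH[of "t # u"] by simp
qed

context prime_modulus
begin

lemma mhs_pint: "n < p \<Longrightarrow> mhs s n \<in> pint"
  by (induction s arbitrary: n) (auto intro!: pint_sum pint_divide_power)

lemma mhs_top_pint: "n < p \<Longrightarrow> mhs_top s n \<in> pint"
  by (cases s) (auto intro!: pint_divide_power mhs_pint)

lemma inverse_reflect:
  assumes "0 < k" "k < p"
  shows "1 / of_nat (p - k) ^ s \<simeq> (-1) ^ s / of_nat k ^ s"
proof -
  have i: "1 / of_nat k \<in> pint" "1 / of_nat (p - k) \<in> pint"
    using assms by (intro pint_inverse; simp)+
  have nz: "(of_nat k :: rat) \<noteq> 0" "(of_nat p - of_nat k :: rat) \<noteq> 0"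
    using assms by auto
  have "1 / of_nat (p - k) \<simeq> (- 1) / of_nat k"
    unfolding rcong_def
  proof (rule bexI)
    show "1 / of_nat k * (1 / of_nat (p - k)) \<in> pint" by (rule pint_mult[OF i])
    show "1 / of_nat (p - k) - - 1 / of_nat k = (of_nat p :: rat) * (1 / of_nat k * (1 / of_nat (p - k)))"
      using nz assms by (simp add: of_nat_diff field_simps)
  qed
  then have "(1 / of_nat (p - k)) ^ s \<simeq> ((- 1) / of_nat k) ^ s"
  proof (rule rcong_power)
    show "- 1 / of_nat k \<in> pint" using pint_uminus[OF i(1)] by simp
  qed
  then show ?thesis by (simp only: power_divide power_one)
qed

lemma mhs_reflect:
  assumes "m < p"
  shows "mhs s (p - 1 - m) \<simeq> (-1) ^ sum_list s * mhs_above s m (p - 1)"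
  using assms
proof (induction s arbitrary: m)
  case (Cons s ss)
  have "mhs (s # ss) (p - 1 - m) = (\<Sum>k\<in>{m<..p - 1}. mhs ss (p - 1 - k) * (1 / of_nat (p - k) ^ s))"
    unfolding mhs.simps
  proof (rule sum.reindex_bij_witness[where i = "\<lambda>k. p - k" and j = "\<lambda>k. p - k"])
    fix k assume "k \<in> {1..p - 1 - m}"
    then have k: "1 \<le> k" "k + m < p" by auto
    then show "p - (p - k) = k" "p - k \<in> {m<..p - 1}" by auto
    have "p - 1 - (p - k) = k - 1" "p - (p - k) = k" using k by auto
    then show "mhs ss (p - 1 - (p - k)) * (1 / of_nat (p - (p - k)) ^ s) = mhs ss (k - 1) / of_nat k ^ s"
      by simp
  next
    fix k assume "k \<in> {m<..p - 1}"
    then have k: "m < k" "k < p" by auto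
    then show "p - (p - k) = k" "p - k \<in> {1..p - 1 - m}" by auto
  qed
  also have "\<dots> \<simeq> (\<Sum>k\<in>{m<..p - 1}. ((-1) ^ sum_list ss * mhs_above ss k (p - 1)) * ((-1) ^ s / of_nat k ^ s))"
  proof (rule rcong_sum)
    fix k assume k: "k \<in> {m<..p - 1}"
    show "mhs ss (p - 1 - k) * (1 / of_nat (p - k) ^ s)
        \<simeq> (-1) ^ sum_list ss * mhs_above ss k (p - 1) * ((-1) ^ s / of_nat k ^ s)"
    proof (rule rcong_mult)
      have k': "k < p" "0 < k" "p - 1 - k < p" using k by auto
      show "mhs ss (p - 1 - k) \<simeq> (-1) ^ sum_list ss * mhs_above ss k (p - 1)"
        by (rule Cons.IH[OF k'(1)])
      show "1 / of_nat (p - k) ^ s \<simeq> (-1) ^ s / of_nat k ^ s"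
        by (rule inverse_reflect[OF k'(2,1)])
      show "mhs ss (p - 1 - k) \<in> pint"
        by (rule mhs_pint[OF k'(3)])
      show "(-1) ^ s / of_nat k ^ s \<in> pint"
        by (rule pint_divide_power[OF pint_sign k'(2,1)])
    qed
  qed
  also have "\<dots> = (-1) ^ sum_list (s # ss) * mhs_above (s # ss) m (p - 1)"
    unfolding mhs_above.simps sum_distrib_left by (intro sum.cong refl) (simp add: power_add)
  finally show ?case .
qed simp

text \<open>
  In the convolution of \<open>mhs_shuffle_convolution\<close> the indices of \<open>v\<close> are at most \<open>p - 1 - m\<close>, where
  \<open>m\<close> is the largest index of \<open>u\<close>. Reflected at \<open>p\<close> they lie above \<open>m\<close>, so the two chains become one.
\<close>

lemma mhs_shuffle:
  assumes "0 \<notin> set u" "0 \<notin> set v"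
  shows "(\<Sum>w\<leftarrow>shuffle (word u) (word v). mhs (index_of_word w) (p - 1))
       \<simeq> (-1) ^ sum_list v * mhs (rev v @ u) (p - 1)"
proof -
  have p0: "p > 0" using prime_gt_0_nat[OF prime_p] .
  have "(\<Sum>w\<leftarrow>shuffle (word u) (word v). mhs (index_of_word w) (p - 1))
      = (\<Sum>m\<le>p - 1. mhs_top u m * mhs v (p - 1 - m))"
    by (rule mhs_shuffle_convolution[OF assms])
  also have "\<dots> \<simeq> (\<Sum>m\<le>p - 1. mhs_top u m * ((-1) ^ sum_list v * mhs_above v m (p - 1)))"
    using p0 by (intro rcong_sum rcong_scale mhs_reflect mhs_top_pint) auto
  also have "\<dots> = (-1) ^ sum_list v * (\<Sum>m\<le>p - 1. mhs_top u m * mhs_above v m (p - 1))"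
    by (simp add: sum_distrib_left mult_ac)
  also have "\<dots> = (-1) ^ sum_list v * mhs (rev v @ u) (p - 1)"
    by (simp add: splice)
  finally show ?thesis .
qed

lemma mhs_reverse:
  "mhs (rev s) (p - 1) \<simeq> (-1) ^ sum_list s * mhs s (p - 1)"
proof -
  have "mhs s (p - 1) \<simeq> (-1) ^ sum_list s * mhs_above s 0 (p - 1)"
    using mhs_reflect[of 0 s] prime_gt_0_nat[OF prime_p] by simp
  moreover have "mhs_above s 0 (p - 1) = mhs (rev s) (p - 1)"
  proof -
    have "(\<Sum>m\<le>p - 1. mhs_top [] m * mhs_above s m (p - 1)) = (\<Sum>m\<in>{0}. mhs_top [] m * mhs_above s m (p - 1))"
      by (intro sum.mono_neutral_right) auto
    then show ?thesis using splice[where n = "p - 1" and u = "[]" and v = s] by simp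
  qed
  ultimately have "mhs s (p - 1) \<simeq> (-1) ^ sum_list s * mhs (rev s) (p - 1)"
    by simp
  then have "(-1) ^ sum_list s * mhs s (p - 1) \<simeq> (-1) ^ sum_list s * ((-1) ^ sum_list s * mhs (rev s) (p - 1))"
    by (rule rcong_scale) simp
  moreover have "(-1) ^ sum_list s * ((-1) ^ sum_list s * mhs (rev s) (p - 1)) = mhs (rev s) (p - 1)"
    by (simp add: minus_one_power_iff)
  ultimately show ?thesis by (metis rcong_sym)
qed

end

section \<open>Depth one and two: Bernoulli numbers\<close>

lemma bernoulli_recurrence:
  assumes "n \<ge> 1"
  shows "(\<Sum>i\<le>n. of_nat (Suc n choose i) * bernoulli_num i) = 0"
proof -
  have "fps_nth (Abs_fps (\<lambda>k. bernoulli_num k / fact k) * (fps_exp 1 - 1)) (Suc n) = 0"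
    unfolding bernoulli_num_egf using assms by (simp add: fps_X_def)
  then have "0 = (\<Sum>i=0..Suc n. bernoulli_num i / fact i * (fps_exp (1::rat) - 1) $ (Suc n - i))"
    by (simp add: fps_mult_nth)
  also have "\<dots> = (\<Sum>i\<le>n. bernoulli_num i / fact i * (1 / fact (Suc n - i)))"
    by (simp add: atLeast0AtMost atMost_Suc) (intro sum.cong refl, simp)
  also have "fact (Suc n) * \<dots> = (\<Sum>i\<le>n. of_nat (Suc n choose i) * bernoulli_num i)"
    unfolding sum_distrib_left
    by (intro sum.cong refl) (simp add: binomial_fact del: fact_Suc)
  finally show ?thesis by simp
qed

lemma bernoulli_0: "bernoulli_num 0 = 1"
proof -
  have "fps_nth (Abs_fps (\<lambda>k. bernoulli_num k / fact k) * (fps_exp 1 - 1)) 1 = 1"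
    unfolding bernoulli_num_egf by simp
  then show ?thesis by (simp add: fps_mult_nth)
qed

text \<open>
  Coefficients of \<open>x \<Sum>\<^bsub>j<k\<^esub> e\<^sup>j\<^sup>x = x / (e\<^sup>x - 1) \<cdot> (e\<^sup>k\<^sup>x - 1)\<close> are compared.
\<close>

lemma faulhaber:
  "(\<Sum>j<k. of_nat j ^ m) =
     (\<Sum>i\<le>m. of_nat (m choose i) * bernoulli_num i * of_nat k ^ (m + 1 - i) / of_nat (m + 1 - i))"
proof -
  let ?b = "Abs_fps (\<lambda>k. bernoulli_num k / fact k)"
  have geo: "(fps_exp 1 - 1) * (\<Sum>j<k. fps_exp (of_nat j)) = fps_exp (of_nat k :: rat) - 1"
    by (induction k) (simp_all add: algebra_simps fps_exp_add_mult)
  have "fps_X * (\<Sum>j<k. fps_exp (of_nat j)) = ?b * (fps_exp (of_nat k) - 1)"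
    unfolding bernoulli_num_egf[symmetric] geo[symmetric] by (simp only: mult.assoc)
  then have "fps_nth (fps_X * (\<Sum>j<k. fps_exp (of_nat j))) (Suc m) = fps_nth (?b * (fps_exp (of_nat k :: rat) - 1)) (Suc m)"
    by simp
  then have "(\<Sum>j<k. of_nat j ^ m / fact m) =
      (\<Sum>i=0..Suc m. bernoulli_num i / fact i * (fps_exp (of_nat k :: rat) - 1) $ (Suc m - i))"
    by (simp add: fps_mult_nth[of ?b] fps_sum_nth)
  also have "\<dots> = (\<Sum>i\<le>m. bernoulli_num i / fact i * (of_nat k ^ (Suc m - i) / fact (Suc m - i)))"
    by (simp add: atLeast0AtMost atMost_Suc) (intro sum.cong refl, simp)
  finally have "fact m * (\<Sum>j<k. of_nat j ^ m / fact m) =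
     fact m * (\<Sum>i\<le>m. bernoulli_num i / fact i * (of_nat k ^ (Suc m - i) / fact (Suc m - i)))"
    by simp
  moreover have "fact m * (\<Sum>j<k. of_nat j ^ m / fact m :: rat) = (\<Sum>j<k. of_nat j ^ m)"
    by (simp add: sum_distrib_left)
  moreover have "fact m * (\<Sum>i\<le>m. bernoulli_num i / fact i * (of_nat k ^ (Suc m - i) / fact (Suc m - i)))
    = (\<Sum>i\<le>m. of_nat (m choose i) * bernoulli_num i * of_nat k ^ (m + 1 - i) / of_nat (m + 1 - i))"
    unfolding sum_distrib_left
  proof (intro sum.cong refl)
    fix i assume "i \<in> {..m}"
    then have "Suc m - i = Suc (m - i)" "i \<le> m" by auto
    then show "fact m * (bernoulli_num i / fact i * (of_nat k ^ (Suc m - i) / fact (Suc m - i)))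
      = of_nat (m choose i) * bernoulli_num i * of_nat k ^ (m + 1 - i) / of_nat (m + 1 - i)"
      by (simp add: binomial_fact mult_ac del: of_nat_Suc)
  qed
  ultimately show ?thesis by simp
qed

context prime_modulus
begin

lemma pint_cancel:
  assumes "of_nat k * x \<in> pint" "0 < k" "k < p" shows "x \<in> pint"
  using pint_divide[OF assms] assms by simp

text \<open>The recurrence for \<open>B\<^sub>n\<close> divides by \<open>n + 1\<close> only, which is less than \<open>p\<close>.\<close>

lemma bernoulli_pint: "n < p - 1 \<Longrightarrow> bernoulli_num n \<in> pint"
proof (induction n rule: less_induct)
  case (less n)
  show ?case
  proof (cases "n = 0")
    case False
    have "(\<Sum>i<n. of_nat (Suc n choose i) * bernoulli_num i) \<in> pint"
      using less by auto
    moreover have "of_nat (Suc n) * bernoulli_num n = - (\<Sum>i<n. of_nat (Suc n choose i) * bernoulli_num i)"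
      using bernoulli_recurrence[of n] False
      by (simp add: lessThan_Suc_atMost[symmetric] del: of_nat_Suc)
    ultimately have "of_nat (Suc n) * bernoulli_num n \<in> pint" using pint_uminus by metis
    then show ?thesis by (rule pint_cancel) (use less.prems in simp_all)
  qed (simp add: bernoulli_0)
qed

lemma fermat_rcong:
  assumes "0 < k" "k < p" shows "of_nat k ^ (p - 1) \<simeq> 1"
proof -
  have "\<not> p dvd k" using assms by (simp add: nat_dvd_not_less)
  then have "[k ^ (p - 1) = 1] (mod p)" by (rule fermat_theorem[OF prime_p])
  then have "int p dvd int (k ^ (p - 1)) - 1"
    by (metis cong_iff_dvd_diff cong_int_iff of_nat_1)
  then obtain z where "int (k ^ (p - 1)) - 1 = int p * z" by (elim dvdE)
  then have "of_int (int (k ^ (p - 1)) - 1) = (of_int (int p * z) :: rat)" by simp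
  then have "of_nat k ^ (p - 1) - 1 = of_nat p * (of_int z :: rat)" by simp
  then show ?thesis unfolding rcong_def by blast
qed

text \<open>In Faulhaber's formula with upper bound \<open>p\<close> every term has a factor \<open>p\<close>, and the other factors
  are \<open>p\<close>-integral since \<open>e < p - 1\<close>.\<close>

lemma sum_powers_zero:
  assumes "0 < e" "e < p - 1" shows "(\<Sum>k=1..p - 1. of_nat k ^ e) \<simeq> 0"
proof -
  have "(\<Sum>k=1..p - 1. of_nat k ^ e) = (\<Sum>j<p. of_nat j ^ e :: rat)"
    using assms by (intro sum.mono_neutral_left) auto
  also have "\<dots> = (\<Sum>i\<le>e. of_nat p * (of_nat (e choose i) * bernoulli_num i * of_nat p ^ (e - i) / of_nat (e + 1 - i)))"
    unfolding faulhaber by (intro sum.cong refl) (simp add: Suc_diff_le)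
  also have "\<dots> \<simeq> (\<Sum>i\<le>e. 0)"
    using assms by (intro rcong_sum rcong_p_mult pint_divide pint_mult bernoulli_pint pint_power) auto
  finally show ?thesis by simp
qed

lemma sum_powers_unit: "(\<Sum>k=1..p - 1. of_nat k ^ (p - 1)) \<simeq> - 1"
proof -
  have "(\<Sum>k=1..p - 1. of_nat k ^ (p - 1)) \<simeq> (\<Sum>k=1..p - 1. 1)"
    by (intro rcong_sum fermat_rcong) auto
  also have "(\<Sum>k=1..p - 1. 1) = (of_nat p - 1 :: rat)"
    using prime_gt_0_nat[OF prime_p] by (simp add: of_nat_diff)
  also have "\<dots> \<simeq> - 1"
    by (rule rcong_diff_eq[OF rcong_p_mult[of 1]]) auto
  finally show ?thesis .
qed

lemma sum_powers_large:
  assumes "p - 1 < e" "e < 2 * (p - 1)" shows "(\<Sum>k=1..p - 1. of_nat k ^ e) \<simeq> 0"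
proof -
  have "(\<Sum>k=1..p - 1. of_nat k ^ e :: rat) = (\<Sum>k=1..p - 1. of_nat k ^ (e - (p - 1)) * of_nat k ^ (p - 1))"
    using assms by (simp add: power_add[symmetric])
  also have "\<dots> \<simeq> (\<Sum>k=1..p - 1. of_nat k ^ (e - (p - 1)) * 1)"
    by (intro rcong_sum rcong_scale fermat_rcong pint_power) auto
  also have "\<dots> \<simeq> 0" using sum_powers_zero[of "e - (p - 1)"] assms by simp
  finally show ?thesis .
qed

lemma inverse_power_rcong:
  assumes "0 < k" "k < p" "s \<le> p - 1"
  shows "1 / of_nat k ^ s \<simeq> of_nat k ^ (p - 1 - s)"
proof -
  have "1 / of_nat k ^ s * of_nat k ^ (p - 1) \<simeq> 1 / of_nat k ^ s * 1"
    using assms by (intro rcong_scale fermat_rcong pint_divide_power) auto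
  moreover have "1 / of_nat k ^ s * of_nat k ^ (p - 1) = (of_nat k ^ (p - 1 - s) :: rat)"
    using assms by (simp add: power_diff)
  ultimately show ?thesis using rcong_sym by simp
qed

lemma mhs_depth1:
  assumes "0 < s" "s < p - 1" shows "mhs [s] (p - 1) \<simeq> 0"
proof -
  have "mhs [s] (p - 1) \<simeq> (\<Sum>k=1..p - 1. of_nat k ^ (p - 1 - s))"
    unfolding mhs.simps using assms by (intro rcong_sum inverse_power_rcong) auto
  also have "\<dots> \<simeq> 0" using assms by (intro sum_powers_zero) auto
  finally show ?thesis .
qed

text \<open>Modulo \<open>p\<close> the upper argument is \<open>-(b + 1)\<close>, and negating it gives the right-hand side.\<close>

lemma binomial_rcong:
  assumes "b + r < p"
  shows "of_nat (p - 1 - b choose r) \<simeq> (- 1) ^ r * of_nat (b + r choose r)"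
proof -
  have ge: "of_nat (p - 1 - b) = (of_nat p - 1 - of_nat b :: rat)"
    using assms by (simp add: of_nat_diff)
  have fr: "1 / fact r \<in> pint"
  proof -
    have "\<not> p dvd fact r" using prime_p assms by (simp add: prime_dvd_fact_iff)
    then have "\<not> int p dvd int (fact r)" by (simp only: of_nat_dvd_iff not_False_eq_True)
    from pint_frac[OF this, of 1] show ?thesis by simp
  qed
  have "(\<Prod>i<r. of_nat (p - 1 - b) - of_nat i :: rat) \<simeq> (\<Prod>i<r. (- (of_nat b + 1) - of_nat i))
     \<and> (\<Prod>i<r. (- (of_nat b + 1) - of_nat i) :: rat) \<in> pint"
  proof (rule rcong_prod)
    show "of_nat (p - 1 - b) - of_nat i \<simeq> - (of_nat b + 1) - of_nat i" for i
      unfolding rcong_def ge by (intro bexI[of _ 1]) auto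
  qed (intro pint_diff pint_uminus pint_add pint_1 pint_of_nat)
  then have "1 / fact r * (\<Prod>i<r. of_nat (p - 1 - b) - of_nat i :: rat)
    \<simeq> 1 / fact r * (\<Prod>i<r. (- (of_nat b + 1) - of_nat i))"
    by (intro rcong_scale fr) auto
  then have "of_nat (p - 1 - b) gchoose r \<simeq> (- (of_nat b + 1)) gchoose r"
    by (simp add: gbinomial_prod_rev atLeast0LessThan)
  also have "(- (of_nat b + 1 :: rat)) gchoose r = (- 1) ^ r * (of_nat (b + r) gchoose r)"
    by (subst gbinomial_minus) simp
  finally show ?thesis by (simp only: binomial_gbinomial)
qed

text \<open>
  After replacing \<open>j\<^sup>-\<^sup>b\<close> by \<open>j\<^bsup>p-1-b\<^esup>\<close> the inner sum is a polynomial in \<open>k\<close> by Faulhaber's formula. In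
  the outer sum, power sums with exponent not divisible by \<open>p - 1\<close> vanish, and only the monomial
  with coefficient involving \<open>B\<^bsub>p-a-b\<^esub>\<close> survives.
\<close>

lemma mhs_depth2:
  assumes "0 < a" "0 < b" "a + b < p - 1"
  shows "mhs [a, b] (p - 1) \<simeq> (- 1) ^ a * fact (a + b - 1) / (fact a * fact b) * bernoulli_num (p - (a + b))"
proof -
  define m where "m = p - 1 - b"
  define c where "c i = of_nat (m choose i) * bernoulli_num i / of_nat (m + 1 - i)" for i
  have m: "m \<ge> 1" "m < p - 1" using assms by (auto simp: m_def)
  have c: "c i \<in> pint" if "i \<le> m" for i
    unfolding c_def using that m by (intro pint_divide pint_mult bernoulli_pint) auto
  have inner: "mhs [b] (k - 1) \<simeq> (\<Sum>i\<le>m. c i * of_nat k ^ (m + 1 - i))" if k: "k \<in> {1..p - 1}" for k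
  proof -
    have "mhs [b] (k - 1) \<simeq> (\<Sum>j=1..k - 1. of_nat j ^ m)"
      unfolding mhs.simps m_def using assms k by (intro rcong_sum inverse_power_rcong) auto
    also have "(\<Sum>j=1..k - 1. of_nat j ^ m) = (\<Sum>j<k. of_nat j ^ m :: rat)"
      using m k by (intro sum.mono_neutral_left) auto
    also have "\<dots> = (\<Sum>i\<le>m. c i * of_nat k ^ (m + 1 - i))"
      unfolding faulhaber c_def by (intro sum.cong refl) simp
    finally show ?thesis .
  qed
  have "mhs [a, b] (p - 1) = (\<Sum>k=1..p - 1. mhs [b] (k - 1) * (1 / of_nat k ^ a))"
    by (subst mhs.simps) (simp del: mhs.simps)
  also have "\<dots> \<simeq> (\<Sum>k=1..p - 1. (\<Sum>i\<le>m. c i * of_nat k ^ (m + 1 - i)) * of_nat k ^ (p - 1 - a))"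
    using assms by (intro rcong_sum rcong_mult inner inverse_power_rcong mhs_pint pint_power) auto
  also have "\<dots> = (\<Sum>i\<le>m. c i * (\<Sum>k=1..p - 1. of_nat k ^ (m + 1 - i + (p - 1 - a))))"
    unfolding sum_distrib_right sum_distrib_left
    by (subst sum.swap, intro sum.cong refl) (simp only: power_add mult.assoc)
  also have "\<dots> \<simeq> (\<Sum>i\<le>m. c i * (if i = p - (a + b) then - 1 else 0))"
  proof (intro rcong_sum rcong_scale)
    fix i assume i: "i \<in> {..m}"
    define e where "e = m + 1 - i + (p - 1 - a)"
    \<comment> \<open>The only multiple of \<open>p - 1\<close> in the range of exponents is \<open>p - 1\<close> itself.\<close>
    have le: "e < 2 * (p - 1)" "e > 0" "e = p - 1 \<longleftrightarrow> i = p - (a + b)"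
      using i assms by (auto simp: e_def m_def)
    show "(\<Sum>k=1..p - 1. of_nat k ^ (m + 1 - i + (p - 1 - a))) \<simeq> (if i = p - (a + b) then - 1 else 0)"
      unfolding e_def[symmetric]
      using le sum_powers_zero[of e] sum_powers_large[of e] sum_powers_unit by (cases e "p - 1" rule: linorder_cases) auto
  qed (use c in auto)
  also have "\<dots> = - c (p - (a + b))"
  proof -
    have "p - (a + b) \<in> {..m}" using assms by (auto simp: m_def)
    then have "(\<Sum>i\<le>m. c i * (if i = p - (a + b) then - 1 else 0)) = (\<Sum>i\<in>{p - (a + b)}. - c i)"
      by (intro sum.mono_neutral_cong_right) auto
    then show ?thesis by simp
  qed
  also have "- c (p - (a + b)) = (of_nat (p - 1 - b choose (a - 1))) * (- (1 / of_nat a * bernoulli_num (p - (a + b))))"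
  proof -
    have "m choose (p - (a + b)) = (m choose (a - 1))"
      using assms by (subst binomial_symmetric) (auto simp: m_def intro: arg_cong2[where f = binomial])
    moreover have "m + 1 - (p - (a + b)) = a" using assms by (auto simp: m_def)
    ultimately show ?thesis unfolding c_def by (simp add: m_def)
  qed
  also have "\<dots> \<simeq> ((- 1) ^ (a - 1) * of_nat (b + (a - 1) choose (a - 1))) * (- (1 / of_nat a * bernoulli_num (p - (a + b))))"
    using assms by (intro rcong_mult binomial_rcong pint_uminus pint_mult bernoulli_pint pint_inverse) auto
  also have "\<dots> = (- 1) ^ a * fact (a + b - 1) / (fact a * fact b) * bernoulli_num (p - (a + b))"
  proof -
    obtain a' where a': "a = Suc a'" using assms by (cases a) auto
    have "of_nat (b + (a - 1) choose (a - 1)) / (of_nat a :: rat) = fact (a + b - 1) / (fact a * fact b)"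
      by (simp add: a' binomial_fact add.commute mult_ac del: of_nat_Suc)
    moreover have "(- 1) ^ (a - 1) * of_nat (b + (a - 1) choose (a - 1)) * - (1 / of_nat a * bernoulli_num (p - (a + b)))
      = (- 1) ^ a * (of_nat (b + (a - 1) choose (a - 1)) / of_nat a) * bernoulli_num (p - (a + b))"
      by (simp add: a' del: of_nat_Suc)
    ultimately show ?thesis by simp
  qed
  finally show ?thesis .
qed

end

section \<open>Normal forms in depth at most five\<close>

lemma count_index_of_word:
  "admissible w \<Longrightarrow> sum_list (index_of_word w) = length w \<and> 0 \<notin> set (index_of_word w)"
proof (induction w)
  case (Cons a w)
  show ?case
  proof (cases "w = []")
    case False
    then have adm: "admissible w" using Cons.prems by (simp add: admissible_def)
    obtain s ss where "index_of_word w = s # ss"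
      using index_of_word_nonempty[OF False] by (cases "index_of_word w") auto
    then show ?thesis using Cons.IH[OF adm] by auto
  qed (use Cons.prems in \<open>simp add: admissible_def\<close>)
qed simp

lemma length_index_of_word:
  "admissible w \<Longrightarrow> length (index_of_word w) = count_list w True"
proof (induction w)
  case (Cons a w)
  show ?case
  proof (cases "w = []")
    case False
    then have adm: "admissible w" using Cons.prems by (simp add: admissible_def)
    obtain s ss where "index_of_word w = s # ss"
      using index_of_word_nonempty[OF False] by (cases "index_of_word w") auto
    then show ?thesis using Cons.IH[OF adm] by auto
  qed (use Cons.prems in \<open>simp add: admissible_def\<close>)
qed simp

lemma shuffle_counts:
  "w \<in> set (shuffle u v) \<Longrightarrow>
     length w = length u + length v \<and> count_list w x = count_list u x + count_list v x"
  by (induction u v arbitrary: w rule: shuffle.induct) fastforce+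

lemma word_counts:
  "0 \<notin> set s \<Longrightarrow> length (word s) = sum_list s \<and> count_list (word s) True = length s"
proof (induction s)
  case (Cons a s)
  have "count_list (replicate m False @ True # word s) True = Suc (length s)" for m
    using Cons by (induction m) auto
  then show ?case using Cons by auto
qed simp

lemma stuffle_counts:
  "w \<in> set (stuffle u v) \<Longrightarrow> 0 \<notin> set u \<Longrightarrow> 0 \<notin> set v \<Longrightarrow>
     sum_list w = sum_list u + sum_list v \<and> 0 \<notin> set w \<and> length w \<le> length u + length v"
  by (induction u v arbitrary: w rule: stuffle.induct) fastforce+

lemma coarsenings_counts:
  "c \<in> set (coarsenings s) \<Longrightarrow> 0 \<notin> set s \<Longrightarrow>
     sum_list c = sum_list s \<and> 0 \<notin> set c \<and> length c \<le> length s"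
proof (induction s arbitrary: c)
  case (Cons a s)
  show ?case
  proof (cases "s = []")
    case False
    then obtain d where d: "d \<in> set (coarsenings s)" "c = a # d \<or> c = (a + hd d) # tl d"
      using Cons.prems by auto
    obtain x y where "d = x # y" using coarsenings_nonempty[OF False d(1)] by (cases d) auto
    then show ?thesis using Cons.IH[OF d(1)] d(2) Cons.prems(2) by auto
  qed (use Cons.prems in auto)
qed simp

context prime_modulus
begin

text \<open>Constants for the bound \<open>p - 1\<close>, so that the simplifier does not unfold the sums.\<close>

definition hsum :: "nat list \<Rightarrow> rat" where
  "hsum s = mhs s (p - 1)"

definition ssum :: "nat list \<Rightarrow> rat" where
  "ssum s = mhs_star s (p - 1)"

lemma hsum_stuffle: "hsum u * hsum v = (\<Sum>w\<leftarrow>stuffle u v. hsum w)"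
  unfolding hsum_def by (rule mhs_stuffle)

lemma hsum_depth1: "0 < a \<Longrightarrow> a < p - 1 \<Longrightarrow> hsum [a] \<simeq> 0"
  unfolding hsum_def by (rule mhs_depth1)

lemma hsum_reverse_even: "even (sum_list s) \<Longrightarrow> hsum (rev s) \<simeq> hsum s"
  and hsum_reverse_odd: "odd (sum_list s) \<Longrightarrow> hsum (rev s) \<simeq> - hsum s"
  using mhs_reverse[of s] by (simp_all only: hsum_def minus_one_power_iff if_True if_False mult_1 mult_minus1)

lemma ssum_coarsenings: "ssum s = (\<Sum>c\<leftarrow>coarsenings s. hsum c)"
  unfolding hsum_def ssum_def by (rule mhs_star_eq_coarsenings)

lemmas ssum_antipode3 = antipode3[where n = "p - 1", folded hsum_def ssum_def]
lemmas ssum_antipode4 = antipode4[where n = "p - 1", folded hsum_def ssum_def]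
lemmas ssum_antipode5 = antipode5[where n = "p - 1", folded hsum_def ssum_def]

lemma ssum_depth1: "ssum [a] = hsum [a]"
  by (simp add: ssum_coarsenings)

lemma hsum_pint [simp, intro]: "hsum s \<in> pint"
  unfolding hsum_def using prime_gt_0_nat[OF prime_p] by (intro mhs_pint) simp

lemma ssum_pint [simp, intro]: "ssum s \<in> pint"
proof -
  have "(\<Sum>c\<leftarrow>cs. hsum c) \<in> pint" for cs
    by (induction cs) auto
  then show ?thesis by (simp add: ssum_coarsenings)
qed

definition depth2_value :: "nat \<Rightarrow> nat \<Rightarrow> rat" where
  "depth2_value a b = (if even (a + b) then 0
     else (- 1) ^ a * fact (a + b - 1) / (fact a * fact b) * bernoulli_num (p - (a + b)))"

text \<open>
  A representative modulo \<open>p\<close> of \<open>hsum s\<close>. Depth two and, in odd weight, depth three are explicit.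
  Otherwise, if depth and weight have the same parity, antipode and reversal reduce the depth; if
  they do not, only reversal is available, and it is used to choose one of \<open>s\<close> and \<open>rev s\<close>.
  The clause for depth five is correct in odd weight only. Longer lists are left alone.
\<close>

fun reduced :: "nat list \<Rightarrow> rat" where
  "reduced [a] = 0"
| "reduced [a, b] = depth2_value a b"
| "reduced [a, b, c] =
     (if odd (a + b + c) then - (depth2_value (a + b) c + depth2_value a (b + c)) / 2
      else if a < c then hsum [c, b, a] else hsum [a, b, c])"
| "reduced [a, b, c, d] =
     (if odd (a + b + c + d) then
        if a < d \<or> a = d \<and> b < c then - hsum [d, c, b, a]
        else if a = d \<and> b = c then 0 else hsum [a, b, c, d]
      else - (reduced [a + b, c, d] + reduced [a, b + c, d] + reduced [a, b, c + d]
              + reduced [b, a] * reduced [c, d]) / 2)"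
| "reduced [a, b, c, d, e] =
     - (reduced [a + b, c, d, e] + reduced [a, b + c, d, e] + reduced [a, b, c + d, e] + reduced [a, b, c, d + e]
        + reduced [a + b + c, d, e] + reduced [a + b, c + d, e] + reduced [a + b, c, d + e]
        + reduced [a, b + c + d, e] + reduced [a, b + c, d + e] + reduced [a, b, c + d + e]
        + reduced [a + b + c + d, e] + reduced [a + b + c, d + e] + reduced [a + b, c + d + e] + reduced [a, b + c + d + e]
        + reduced [b, a] * reduced [c, d, e] - reduced [a, b, c] * reduced [d, e]) / 2"
| "reduced s = hsum s"

lemma reduced_depth2: "reduced [a, b] = depth2_value a b"
  by simp

lemma reduced_depth4_even:
  "even (a + b + c + d) \<Longrightarrow> reduced [a, b, c, d] =
     - (reduced [a + b, c, d] + reduced [a, b + c, d] + reduced [a, b, c + d] + reduced [b, a] * reduced [c, d]) / 2"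
  by (subst reduced.simps) (simp del: reduced.simps)

lemma rcong_half:
  assumes "odd p" "2 * x \<simeq> y" shows "x \<simeq> y / 2"
proof -
  have "p \<noteq> 2" using assms by auto
  then have "2 < p" using prime_ge_2_nat[OF prime_p] by simp
  then have "1 / 2 * (2 * x) \<simeq> 1 / 2 * y"
    using pint_inverse[of 2] assms(2) by (intro rcong_scale) auto
  then show ?thesis by simp
qed

text \<open>
  In even weight the two orders of the entries agree by reversal, while their sum is
  \<open>hsum [a] * hsum [b] - hsum [a + b]\<close> and vanishes.
\<close>

lemma hsum_depth2:
  assumes "0 < a" "0 < b" "a + b < p - 1"
  shows "hsum [a, b] \<simeq> depth2_value a b"
proof (cases "even (a + b)")
  case False
  then show ?thesis using mhs_depth2[OF assms, folded hsum_def] by (simp only: depth2_value_def if_False)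
next
  case True
  have "odd p" using prime_p assms by (intro prime_odd_nat) auto
  have "hsum [a] * hsum [b] \<simeq> 0 * 0"
    using assms by (intro rcong_mult hsum_depth1 hsum_pint) auto
  moreover have "hsum [a] * hsum [b] = hsum [a, b] + hsum [b, a] + hsum [a + b]"
    unfolding hsum_stuffle by simp
  ultimately have "hsum [a, b] + hsum [b, a] + hsum [a + b] \<simeq> 0" by simp
  moreover have "hsum [b, a] \<simeq> hsum [a, b]"
    using hsum_reverse_even[of "[a, b]"] True by simp
  moreover have "hsum [a + b] \<simeq> 0" using assms by (intro hsum_depth1) auto
  ultimately have "(hsum [a, b] + hsum [b, a] + hsum [a + b]) - (hsum [b, a] + hsum [a + b])
      \<simeq> 0 - (hsum [a, b] + 0)"
    by (intro rcong_diff rcong_add)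
  then have "2 * hsum [a, b] \<simeq> 0"
    by (rule rcong_diff_eq) simp
  from rcong_half[OF \<open>odd p\<close> this] show ?thesis using True by (simp add: depth2_value_def)
qed

lemma depth2_value_pint:
  assumes "0 < a" "0 < b" "a + b < p - 1" shows "depth2_value a b \<in> pint"
  by (rule pint_rcong[OF rcong_sym[OF hsum_depth2[OF assms]] hsum_pint])

lemma ssum_reverse3: 
  assumes "0 < a" "0 < b" "0 < c" "a + b + c < p - 1"
  shows "ssum [c, b, a] \<simeq> hsum [a, b, c]"
proof -
  have "ssum [c, b, a] \<simeq> hsum [a, b, c] - 0 * hsum [b, c] + ssum [b, a] * 0"
    unfolding ssum_antipode3 ssum_depth1
    using assms by (intro rcong_add rcong_diff rcong_mult rcong_refl hsum_depth1) auto
  then show ?thesis by simp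
qed

text \<open>
  In odd weight the star sum is \<open>hsum [a, b, c]\<close> by the antipode relation. Its expansion over
  coarsenings, reversed, starts with \<open>- hsum [a, b, c]\<close>, so the two do not cancel.
\<close>

lemma hsum_depth3:
  assumes "0 < a" "0 < b" "0 < c" "a + b + c < p - 1"
  shows "hsum [a, b, c] \<simeq> reduced [a, b, c]"
proof (cases "odd (a + b + c)")
  case True
  have "odd p" using prime_p assms by (intro prime_odd_nat) auto
  have "ssum [c, b, a] = hsum [c, b, a] + hsum [c + b, a] + hsum [c, b + a] + hsum [c + b + a]"
    by (simp add: ssum_coarsenings add_ac)
  also have "\<dots> \<simeq> - hsum [a, b, c] + - hsum [a, b + c] + - hsum [a + b, c] + 0"
    using hsum_reverse_odd[of "[a, b, c]"] hsum_reverse_odd[of "[a, b + c]"] hsum_reverse_odd[of "[a + b, c]"]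
      hsum_depth1[of "a + b + c"] True assms
    by (intro rcong_add) (simp_all add: add_ac)
  finally have "hsum [a, b, c] \<simeq> - hsum [a, b, c] + - hsum [a, b + c] + - hsum [a + b, c] + 0"
    using ssum_reverse3[OF assms] rcong_sym rcong_trans by blast
  then have "2 * hsum [a, b, c] \<simeq> - (hsum [a + b, c] + hsum [a, b + c])"
    by (rule rcong_diff_eq) simp
  also have "\<dots> \<simeq> - (depth2_value (a + b) c + depth2_value a (b + c))"
    using assms by (intro rcong_uminus rcong_add hsum_depth2) auto
  finally show ?thesis using rcong_half[OF \<open>odd p\<close>] True by simp
next
  case False
  then have "hsum [a, b, c] \<simeq> hsum [c, b, a]"
    using rcong_sym[OF hsum_reverse_even[of "[a, b, c]"]] by (simp add: add.assoc)
  then show ?thesis using False by simp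
qed

lemma reduced3_pint:
  assumes "0 < a" "0 < b" "0 < c" "a + b + c < p - 1"
  shows "reduced [a, b, c] \<in> pint"
  by (rule pint_rcong[OF rcong_sym[OF hsum_depth3[OF assms]] hsum_pint])

lemma ssum_depth2:
  assumes "0 < a" "0 < b" "a + b < p - 1"
  shows "ssum [a, b] \<simeq> depth2_value a b"
proof -
  have "ssum [a, b] = hsum [a, b] + hsum [a + b]"
    by (simp add: ssum_coarsenings)
  also have "\<dots> \<simeq> depth2_value a b + 0"
    using assms by (intro rcong_add hsum_depth2 hsum_depth1) auto
  finally show ?thesis by simp
qed

text \<open>
  In even weight the argument of depth three applies with both signs changed. The product of two
  sums of depth two now survives in the antipode relation.
\<close>

lemma hsum_depth4:
  assumes "0 < a" "0 < b" "0 < c" "0 < d" "a + b + c + d < p - 1"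
  shows "hsum [a, b, c, d] \<simeq> reduced [a, b, c, d]"
proof -
  have "odd p" using prime_p assms by (intro prime_odd_nat) auto
  show ?thesis
  proof (cases "odd (a + b + c + d)")
    case True
    have rev: "hsum [d, c, b, a] \<simeq> - hsum [a, b, c, d]"
      using hsum_reverse_odd[of "[a, b, c, d]"] True by (simp add: add.assoc)
    have "hsum [a, b, c, d] \<simeq> - hsum [d, c, b, a]"
      using rcong_sym[OF rcong_uminus[OF rev]] by simp
    moreover have "hsum [a, b, c, d] \<simeq> 0" if "a = d" "b = c"
    proof -
      have "hsum [a, b, c, d] \<simeq> - hsum [a, b, c, d]" using rev that by simp
      then have "2 * hsum [a, b, c, d] \<simeq> 0"
        by (rule rcong_diff_eq) simp
      then show ?thesis using rcong_half[OF \<open>odd p\<close>] by force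
    qed
    ultimately show ?thesis using True by simp
  next
    case False
    have ev: "even (d + (c + (b + a)))" using False by (simp add: add_ac)
    have "ssum [d, c, b, a] =
       hsum (rev [a, b, c, d]) + (hsum (rev [a, b, c + d]) + hsum (rev [a, b + c, d]) + hsum (rev [a + b, c, d]))
       + hsum [d + c + b, a] + hsum [d + c, b + a] + hsum [d, c + b + a] + hsum [d + c + b + a]"
      by (simp add: ssum_coarsenings add_ac)
    also have "\<dots> \<simeq> hsum [a, b, c, d] + (reduced [a, b, c + d] + reduced [a, b + c, d] + reduced [a + b, c, d])
       + depth2_value (d + c + b) a + depth2_value (d + c) (b + a) + depth2_value d (c + b + a) + 0"
    proof (intro rcong_add)
      have r: "hsum (rev s) \<simeq> hsum s" if "even (sum_list s)" for s
        using hsum_reverse_even that by blast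
      show "hsum (rev [a, b, c, d]) \<simeq> hsum [a, b, c, d]"
        by (rule r) (use False in \<open>simp add: add_ac\<close>)
      show "hsum (rev [a, b, c + d]) \<simeq> reduced [a, b, c + d]"
        using False assms by (intro rcong_trans[OF r hsum_depth3]) (auto simp: add_ac)
      show "hsum (rev [a, b + c, d]) \<simeq> reduced [a, b + c, d]"
        using False assms by (intro rcong_trans[OF r hsum_depth3]) (auto simp: add_ac)
      show "hsum (rev [a + b, c, d]) \<simeq> reduced [a + b, c, d]"
        using False assms by (intro rcong_trans[OF r hsum_depth3]) (auto simp: add_ac)
    qed (use assms in \<open>intro hsum_depth2 hsum_depth1; simp\<close>)+
    also have "\<dots> = hsum [a, b, c, d] + (reduced [a, b, c + d] + reduced [a, b + c, d] + reduced [a + b, c, d])"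
      using ev by (simp add: depth2_value_def add_ac del: reduced.simps)
    finally have 1: "ssum [d, c, b, a] \<simeq>
      hsum [a, b, c, d] + (reduced [a, b, c + d] + reduced [a, b + c, d] + reduced [a + b, c, d])" .
    have "ssum [d, c, b, a] \<simeq> - hsum [a, b, c, d] + 0 * hsum [b, c, d]
        - depth2_value b a * depth2_value c d + ssum [c, b, a] * 0"
      unfolding ssum_antipode4
      using assms by (intro rcong_add rcong_diff rcong_mult rcong_refl ssum_depth2 hsum_depth2 depth2_value_pint)
         (auto simp: ssum_depth1 hsum_depth1 simp del: reduced.simps)
    from rcong_diff[OF this 1] have "0 \<simeq> - 2 * hsum [a, b, c, d] - (reduced [a, b, c + d] + reduced [a, b + c, d] + reduced [a + b, c, d]
        + depth2_value b a * depth2_value c d)"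
      by (rule rcong_diff_eq) (simp del: reduced.simps)
    then have "2 * hsum [a, b, c, d] \<simeq> - (reduced [a + b, c, d] + reduced [a, b + c, d] + reduced [a, b, c + d]
        + reduced [b, a] * reduced [c, d])"
      by (rule rcong_diff_eq) (simp only: reduced_depth2)
    from rcong_half[OF \<open>odd p\<close> this] show ?thesis
      using False by (subst reduced_depth4_even) simp_all
  qed
qed

text \<open>
  As in depth three; of the products in the antipode relation those without a factor of depth one
  remain.
\<close>

lemma hsum_depth5:
  assumes "0 < a" "0 < b" "0 < c" "0 < d" "0 < e" "a + b + c + d + e < p - 1" and odd: "odd (a + b + c + d + e)"
  shows "hsum [a, b, c, d, e] \<simeq> reduced [a, b, c, d, e]"
proof -
  define L where "L = reduced [a + b, c, d, e] + reduced [a, b + c, d, e] + reduced [a, b, c + d, e] + reduced [a, b, c, d + e]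
        + reduced [a + b + c, d, e] + reduced [a + b, c + d, e] + reduced [a + b, c, d + e]
        + reduced [a, b + c + d, e] + reduced [a, b + c, d + e] + reduced [a, b, c + d + e]
        + reduced [a + b + c + d, e] + reduced [a + b + c, d + e] + reduced [a + b, c + d + e] + reduced [a, b + c + d + e]"
  have "odd p" using prime_p assms by (intro prime_odd_nat) auto
  have r: "hsum s \<simeq> - hsum (rev s)" if "odd (sum_list s)" for s
    using rcong_sym[OF rcong_uminus[OF hsum_reverse_odd[OF that]]] by simp
  have "ssum [e, d, c, b, a] = (\<Sum>s\<leftarrow>coarsenings [e, d, c, b, a]. hsum s)"
    by (rule ssum_coarsenings)
  also have "\<dots> \<simeq> (\<Sum>s\<leftarrow>coarsenings [e, d, c, b, a]. - hsum (rev s))"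
  proof (intro rcong_sum_list r)
    fix s assume "s \<in> set (coarsenings [e, d, c, b, a])"
    from coarsenings_counts[OF this] have "sum_list s = sum_list [e, d, c, b, a]"
      using assms by (simp del: coarsenings.simps)
    then show "odd (sum_list s)" using odd by (simp add: add_ac)
  qed
  also have "\<dots> = - (hsum [a, b, c, d, e] + (hsum [a + b, c, d, e] + hsum [a, b + c, d, e] + hsum [a, b, c + d, e] + hsum [a, b, c, d + e]
        + hsum [a + b + c, d, e] + hsum [a + b, c + d, e] + hsum [a + b, c, d + e]
        + hsum [a, b + c + d, e] + hsum [a, b + c, d + e] + hsum [a, b, c + d + e]
        + hsum [a + b + c + d, e] + hsum [a + b + c, d + e] + hsum [a + b, c + d + e] + hsum [a, b + c + d + e])
        + hsum [a + b + c + d + e])"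
    by (simp add: add_ac)
  also have "\<dots> \<simeq> - (hsum [a, b, c, d, e] + L + 0)"
    unfolding L_def reduced_depth2 using assms
    by (intro rcong_uminus rcong_add rcong_refl hsum_depth4 hsum_depth3 hsum_depth2 hsum_depth1) auto
  finally have 1: "ssum [e, d, c, b, a] \<simeq> - (hsum [a, b, c, d, e] + L + 0)" .
  have "ssum [e, d, c, b, a] \<simeq> hsum [a, b, c, d, e] - 0 * hsum [b, c, d, e]
     + depth2_value b a * reduced [c, d, e] - reduced [a, b, c] * depth2_value d e
     + ssum [d, c, b, a] * 0"
    unfolding ssum_antipode5
    using assms rcong_trans[OF ssum_reverse3[of a b c] hsum_depth3[of a b c]]
    by (intro rcong_add rcong_diff rcong_mult rcong_refl ssum_depth2 hsum_depth2 hsum_depth3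
          depth2_value_pint reduced3_pint)
       (auto simp: ssum_depth1 hsum_depth1 simp del: reduced.simps)
  from rcong_diff[OF this 1] have "0 \<simeq> 2 * hsum [a, b, c, d, e] + L + depth2_value b a * reduced [c, d, e] - reduced [a, b, c] * depth2_value d e"
    by (rule rcong_diff_eq) (simp del: reduced.simps)
  then have "2 * hsum [a, b, c, d, e] \<simeq> - (L + reduced [b, a] * reduced [c, d, e] - reduced [a, b, c] * reduced [d, e])"
    by (rule rcong_diff_eq[OF rcong_sym]) (simp only: reduced_depth2)
  from rcong_half[OF \<open>odd p\<close> this] show ?thesis
    by (subst reduced.simps) (simp only: L_def)
qed

lemma hsum_reduced:
  assumes "0 \<notin> set s" "sum_list s < p - 1" "s \<noteq> []"
    "length s \<le> 4 \<or> length s = 5 \<and> odd (sum_list s)"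
  shows "hsum s \<simeq> reduced s"
proof -
  have "length s > 0" "length s \<le> 5" using assms(3,4) by auto
  then have "length s = 1 \<or> length s = 2 \<or> length s = 3 \<or> length s = 4 \<or> length s = 5"
    by arith
  then consider (1) a where "s = [a]" | (2) a b where "s = [a, b]" | (3) a b c where "s = [a, b, c]"
    | (4) a b c d where "s = [a, b, c, d]" | (5) a b c d e where "s = [a, b, c, d, e]"
    by (auto simp: length_Suc_conv numeral_eq_Suc)
  then show ?thesis
  proof cases
    case 1
    then show ?thesis using assms hsum_depth1[of a] by simp
  next
    case 2
    then show ?thesis using assms hsum_depth2[of a b] by simp
  next
    case 3
    have "hsum [a, b, c] \<simeq> reduced [a, b, c]" using assms 3 by (intro hsum_depth3) auto
    then show ?thesis by (simp only: 3)
  next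
    case 4
    have "hsum [a, b, c, d] \<simeq> reduced [a, b, c, d]" using assms 4 by (intro hsum_depth4) auto
    then show ?thesis by (simp only: 4)
  next
    case 5
    have "hsum [a, b, c, d, e] \<simeq> reduced [a, b, c, d, e]" using assms 5 by (intro hsum_depth5) (auto simp: add_ac)
    then show ?thesis by (simp only: 5)
  qed
qed

lemma reduced_shuffle:
  assumes "0 \<notin> set u" "0 \<notin> set v" "sum_list u + sum_list v < p - 1" "u \<noteq> []" "v \<noteq> []"
    "length u + length v \<le> 4 \<or> length u + length v = 5 \<and> odd (sum_list u + sum_list v)"
  shows "(\<Sum>w\<leftarrow>shuffle (word u) (word v). reduced (index_of_word w))
      \<simeq> (- 1) ^ sum_list v * reduced (rev v @ u)"
proof -
  have "(\<Sum>w\<leftarrow>shuffle (word u) (word v). hsum (index_of_word w))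
      \<simeq> (\<Sum>w\<leftarrow>shuffle (word u) (word v). reduced (index_of_word w))"
  proof (intro rcong_sum_list hsum_reduced)
    fix w assume w: "w \<in> set (shuffle (word u) (word v))"
    have adm: "admissible w" using admissible_shuffle[OF admissible_word admissible_word w] by simp
    have sm: "sum_list (index_of_word w) = sum_list u + sum_list v"
      and nz: "0 \<notin> set (index_of_word w)"
      and len: "length (index_of_word w) = length u + length v"
      using count_index_of_word[OF adm] length_index_of_word[OF adm] shuffle_counts[OF w, of True]
        word_counts[OF assms(1)] word_counts[OF assms(2)] by auto
    show "0 \<notin> set (index_of_word w)" by (rule nz)
    show "sum_list (index_of_word w) < p - 1" using sm assms by simp
    show "index_of_word w \<noteq> []" using len assms by auto
    show "length (index_of_word w) \<le> 4 \<or> length (index_of_word w) = 5 \<and> odd (sum_list (index_of_word w))"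
      using len sm assms by simp
  qed
  then have "(\<Sum>w\<leftarrow>shuffle (word u) (word v). reduced (index_of_word w))
      \<simeq> (\<Sum>w\<leftarrow>shuffle (word u) (word v). hsum (index_of_word w))" by (rule rcong_sym)
  also have "\<dots> \<simeq> (- 1) ^ sum_list v * hsum (rev v @ u)" using mhs_shuffle[OF assms(1,2)] by (simp only: hsum_def)
  also have "\<dots> \<simeq> (- 1) ^ sum_list v * reduced (rev v @ u)"
    using assms by (intro rcong_scale hsum_reduced) (auto simp: add_ac)
  finally show ?thesis .
qed

lemma reduced_stuffle:
  assumes "0 < a" "0 \<notin> set v" "a + sum_list v < p - 1" "v \<noteq> []" "length v \<le> 3"
  shows "(\<Sum>w\<leftarrow>stuffle [a] v. reduced w) \<simeq> 0"
proof -
  have "(\<Sum>w\<leftarrow>stuffle [a] v. hsum w) \<simeq> (\<Sum>w\<leftarrow>stuffle [a] v. reduced w)"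
  proof (intro rcong_sum_list hsum_reduced)
    fix w assume w: "w \<in> set (stuffle [a] v)"
    have c: "sum_list w = a + sum_list v" "0 \<notin> set w" "length w \<le> Suc (length v)"
      using stuffle_counts[OF w] assms by auto
    show "0 \<notin> set w" by (rule c)
    show "sum_list w < p - 1" "length w \<le> 4 \<or> length w = 5 \<and> odd (sum_list w)"
      using c assms by auto
    show "w \<noteq> []" using c assms by auto
  qed
  then have "(\<Sum>w\<leftarrow>stuffle [a] v. reduced w) \<simeq> (\<Sum>w\<leftarrow>stuffle [a] v. hsum w)" by (rule rcong_sym)
  also have "\<dots> = hsum [a] * hsum v" by (rule hsum_stuffle[symmetric])
  also have "\<dots> \<simeq> 0 * hsum v"
    using assms by (intro rcong_mult hsum_depth1) auto
  finally show ?thesis by simp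
qed

lemma ssum_reduced:
  assumes "0 \<notin> set s" "sum_list s < p - 1" "s \<noteq> []" "length s \<le> 4"
  shows "ssum s \<simeq> (\<Sum>c\<leftarrow>coarsenings s. reduced c)"
  unfolding ssum_coarsenings
proof (intro rcong_sum_list hsum_reduced)
  fix c assume c: "c \<in> set (coarsenings s)"
  show "0 \<notin> set c" "sum_list c < p - 1" "length c \<le> 4 \<or> length c = 5 \<and> odd (sum_list c)"
    using coarsenings_counts[OF c assms(1)] assms by auto
  show "c \<noteq> []" by (rule coarsenings_nonempty[OF assms(3) c])
qed

end

section \<open>Solving the relations\<close>

context prime_modulus
begin

lemma zero_add: "x \<simeq> 0 \<Longrightarrow> y \<simeq> 0 \<Longrightarrow> x + y \<simeq> 0"
  using rcong_add by fastforce

lemma zero_scale: "x \<simeq> 0 \<Longrightarrow> c \<in> pint \<Longrightarrow> c * x \<simeq> 0"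
  using rcong_scale by fastforce

text \<open>
  The linear combinations below have coefficients whose denominators are products of small powers of
  \<open>2\<close>, \<open>3\<close> and \<open>5\<close>. Divisibility by \<open>30\<^sup>6\<close> is a test for this that the simplifier can carry out.
\<close>

lemma pint_smooth:
  assumes "p > 7" "numeral b dvd (30 ^ 6 :: nat)"
  shows "numeral a / numeral b \<in> pint" "1 / numeral b \<in> pint"
    "- (numeral a / numeral b) \<in> pint" "- (1 / numeral b) \<in> pint"
proof -
  have "\<not> p dvd 30"
  proof
    assume "p dvd 30"
    also have "(30 :: nat) = 2 * 3 * 5" by simp
    finally have "p dvd 2 \<or> p dvd 3 \<or> p dvd 5" using prime_p by (simp only: prime_dvd_mult_iff disj_assoc)
    then show False using assms(1) by (auto dest: dvd_imp_le)
  qed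
  then have "\<not> p dvd 30 ^ 6" using prime_p prime_dvd_power by blast
  then have "\<not> p dvd numeral b" using assms(2) dvd_trans by blast
  then have "\<not> int p dvd int (numeral b)" by (simp only: of_nat_dvd_iff not_False_eq_True)
  then have "\<not> int p dvd numeral b" by simp
  from pint_frac[OF this, of "numeral a"] pint_frac[OF this, of 1]
  show "numeral a / numeral b \<in> pint" "1 / numeral b \<in> pint"
    "- (numeral a / numeral b) \<in> pint" "- (1 / numeral b) \<in> pint"
    by (auto intro: pint_uminus)
qed

lemma pint_neg_numeral [simp]: "- numeral a \<in> pint" "- 1 \<in> pint"
  by (auto intro: pint_uminus)

lemma p_greater_10:
  assumes "p > 7" shows "p > 10"
proof (rule ccontr)
  assume "\<not> p > 10"
  then have "p = 8 \<or> p = 9 \<or> p = 10" using assms by auto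
  moreover have "\<not> prime (8 :: nat)" "\<not> prime (9 :: nat)" "\<not> prime (10 :: nat)"
    using prime_product[of 2 4] prime_product[of 3 3] prime_product[of 2 5] by auto
  ultimately show False using prime_p by auto
qed

lemma replicate_numeral: "replicate (numeral k) x = x # replicate (pred_numeral k) x"
  by (simp add: numeral_eq_Suc)

text \<open>
  Evaluation of the normal forms on concrete indices. Reading an index off a word produces successors;
  the last rule makes their entries numerals again.
\<close>

lemmas evaluate = depth2_value_def fact_numeral replicate_numeral numeral_2_eq_2[symmetric]

text \<open>
  The coefficients of the final combination, here and below, solve the linear system that makes all
  other sums of depth four cancel.
\<close>

lemma hsum_4111:
  assumes p: "p > 7"
  shows "hsum [4, 1, 1, 1] \<simeq> 27 / 16 * bernoulli_num (p - 7)"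
proof -
  note p = p_greater_10[OF p]
  have r1: "hsum [2, 1, 3, 1] - 2 * hsum [3, 1, 1, 2] - hsum [3, 1, 2, 1] - 3 * bernoulli_num (p - 7) \<simeq> 0"
      (is "?r1 \<simeq> 0")
    by (rule rcong_diff_eq[OF reduced_stuffle[of 1 "[2, 1, 3]"]])
      (use p in \<open>simp_all add: evaluate\<close>)
  have r2: "- hsum [1, 3, 2, 1] + hsum [2, 1, 3, 1] + 2 * hsum [2, 3, 1, 1] \<simeq> 0"
      (is "?r2 \<simeq> 0")
    by (rule rcong_diff_eq[OF reduced_stuffle[of 1 "[2, 3, 1]"]])
      (use p in \<open>simp_all add: evaluate\<close>)
  have r3: "hsum [1, 3, 2, 1] + hsum [3, 1, 2, 1] + 2 * hsum [3, 2, 1, 1] + 3 * bernoulli_num (p - 7) \<simeq> 0"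
      (is "?r3 \<simeq> 0")
    by (rule rcong_diff_eq[OF reduced_stuffle[of 1 "[3, 2, 1]"]])
      (use p in \<open>simp_all add: evaluate\<close>)
  have r4: "hsum [2, 2, 1, 2] + 3 * hsum [2, 2, 2, 1] - 9 * bernoulli_num (p - 7) \<simeq> 0"
      (is "?r4 \<simeq> 0")
    by (rule rcong_diff_eq[OF reduced_stuffle[of 2 "[2, 2, 1]"]])
      (use p in \<open>simp_all add: evaluate\<close>)
  have r5: "- 2 * hsum [1, 3, 2, 1] - hsum [2, 2, 2, 1] - 2 * hsum [3, 1, 2, 1] - 3 * hsum [3, 2, 1, 1] \<simeq> 0"
      (is "?r5 \<simeq> 0")
    by (rule rcong_diff_eq[OF reduced_shuffle[of "[1]" "[1, 2, 3]"]])
      (use p in \<open>simp_all add: evaluate\<close>)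
  have r6: "2 * hsum [1, 3, 2, 1] - 2 * hsum [2, 1, 3, 1] - hsum [2, 2, 2, 1] - 3 * hsum [2, 3, 1, 1] \<simeq> 0"
      (is "?r6 \<simeq> 0")
    by (rule rcong_diff_eq[OF reduced_shuffle[of "[1]" "[1, 3, 2]"]])
      (use p in \<open>simp_all add: evaluate\<close>)
  have r7: "- 4 * hsum [2, 1, 3, 1] + hsum [2, 2, 1, 2] - hsum [2, 2, 2, 1] \<simeq> 0"
      (is "?r7 \<simeq> 0")
    by (rule rcong_diff_eq[OF reduced_shuffle[of "[2]" "[1, 2, 2]"]])
      (use p in \<open>simp_all add: evaluate\<close>)
  have r8: "hsum [3, 1, 1, 2] + 2 * hsum [3, 1, 2, 1] + 5 * hsum [3, 2, 1, 1] + 12 * hsum [4, 1, 1, 1] \<simeq> 0"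
      (is "?r8 \<simeq> 0")
    by (rule rcong_diff_eq[OF reduced_shuffle[of "[2]" "[3, 1, 1]"]])
      (use p in \<open>simp_all add: evaluate\<close>)
  have "(1 / 24) * ?r1 + (3 / 8) * ?r2 + (- 11 / 24) * ?r3 + (1 / 48) * ?r4 + (- 1 / 6) * ?r5
      + (1 / 4) * ?r6 + (- 1 / 48) * ?r7 + (1 / 12) * ?r8 \<simeq> 0"
    by (intro r1 r2 r3 r4 r5 r6 r7 r8 zero_add zero_scale)
      (use p in \<open>simp_all add: pint_smooth\<close>)
  then show ?thesis by (rule rcong_diff_eq) (simp add: algebra_simps)
qed

lemma hsum_2221:
  assumes p: "p > 7"
  shows "hsum [2, 2, 2, 1] \<simeq> 27 / 16 * bernoulli_num (p - 7)"
proof -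
  note p = p_greater_10[OF p]
  have r1: "- hsum [2, 2, 1, 2] - 3 * hsum [2, 2, 2, 1] + 9 * bernoulli_num (p - 7) \<simeq> 0"
      (is "?r1 \<simeq> 0")
    by (rule rcong_diff_eq[OF reduced_stuffle[of 2 "[1, 2, 2]"]])
      (use p in \<open>simp_all add: evaluate\<close>)
  have r2: "- hsum [2, 1, 3, 1] - hsum [2, 3, 1, 1] + hsum [3, 1, 1, 2] - hsum [3, 2, 1, 1] \<simeq> 0"
      (is "?r2 \<simeq> 0")
    by (rule rcong_diff_eq[OF reduced_stuffle[of 3 "[1, 1, 2]"]])
      (use p in \<open>simp_all add: evaluate\<close>)
  have r3: "2 * hsum [2, 1, 3, 1] - hsum [2, 2, 1, 2] - 3 * hsum [3, 1, 1, 2] - 2 * hsum [3, 1, 2, 1] \<simeq> 0"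
      (is "?r3 \<simeq> 0")
    by (rule rcong_diff_eq[OF reduced_shuffle[of "[1]" "[2, 1, 3]"]])
      (use p in \<open>simp_all add: evaluate\<close>)
  have r4: "- 4 * hsum [2, 1, 3, 1] + hsum [2, 2, 1, 2] - hsum [2, 2, 2, 1] \<simeq> 0"
      (is "?r4 \<simeq> 0")
    by (rule rcong_diff_eq[OF reduced_shuffle[of "[2]" "[1, 2, 2]"]])
      (use p in \<open>simp_all add: evaluate\<close>)
  have r5: "hsum [2, 2, 1, 2] + 3 * hsum [2, 2, 2, 1] + 6 * hsum [2, 3, 1, 1] + 4 * hsum [3, 1, 2, 1]
      + 6 * hsum [3, 2, 1, 1] \<simeq> 0"
      (is "?r5 \<simeq> 0")
    by (rule rcong_diff_eq[OF reduced_shuffle[of "[2]" "[2, 2, 1]"]])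
      (use p in \<open>simp_all add: evaluate\<close>)
  have "(- 3 / 16) * ?r1 + (3 / 4) * ?r2 + (1 / 4) * ?r3 + (- 1 / 16) * ?r4 + (1 / 8) * ?r5 \<simeq> 0"
    by (intro r1 r2 r3 r4 r5 zero_add zero_scale)
      (use p in \<open>simp_all add: pint_smooth\<close>)
  then show ?thesis by (rule rcong_diff_eq) (simp add: algebra_simps)
qed

lemma hsum_weight4:
  assumes p: "p > 7"
  shows "hsum [2, 1, 1] \<simeq> 0" "hsum [1, 2, 1] \<simeq> 0"
proof -
  note p = p_greater_10[OF p]
  have r1: "hsum [1, 2, 1] + 2 * hsum [2, 1, 1] \<simeq> 0"
      (is "?r1 \<simeq> 0")
    by (rule rcong_diff_eq[OF reduced_stuffle[of 1 "[2, 1]"]])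
      (use p in \<open>simp_all add: evaluate\<close>)
  have r2: "2 * hsum [1, 2, 1] + 3 * hsum [2, 1, 1] \<simeq> 0"
      (is "?r2 \<simeq> 0")
    by (rule rcong_diff_eq[OF reduced_shuffle[of "[1]" "[2, 1]"]])
      (use p in \<open>simp_all add: evaluate\<close>)
  have c211: "2 * ?r1 + (- 1) * ?r2 \<simeq> 0"
    by (intro r1 r2 zero_add zero_scale) auto
  have c121: "(- 3) * ?r1 + 2 * ?r2 \<simeq> 0"
    by (intro r1 r2 zero_add zero_scale) auto
  show "hsum [2, 1, 1] \<simeq> 0" by (rule rcong_diff_eq[OF c211]) simp
  show "hsum [1, 2, 1] \<simeq> 0" by (rule rcong_diff_eq[OF c121]) simp
qed

text \<open>
  The first four relations express the other sums that occur by \<open>hsum [4, 1, 1]\<close>. The last one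
  starts from depth four; its normal form contains products of two depth-two sums of weight 3,
  and these fix the multiple.
\<close>

lemma hsum_weight6:
  assumes p: "p > 7"
  shows "hsum [4, 1, 1] \<simeq> - 1 / 6 * bernoulli_num (p - 3) ^ 2"
    "hsum [1, 4, 1] \<simeq> 1 / 3 * bernoulli_num (p - 3) ^ 2"
    "hsum [2, 3, 1] \<simeq> - 1 / 2 * bernoulli_num (p - 3) ^ 2"
proof -
  note p = p_greater_10[OF p]
  have r1: "hsum [1, 4, 1] + 2 * hsum [4, 1, 1] \<simeq> 0"
      (is "?r1 \<simeq> 0")
    by (rule rcong_diff_eq[OF reduced_stuffle[of 1 "[4, 1]"]])
      (use p in \<open>simp_all add: evaluate\<close>)
  have r2: "2 * hsum [1, 4, 1] + hsum [2, 3, 1] + hsum [3, 2, 1] + 3 * hsum [4, 1, 1] \<simeq> 0"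
      (is "?r2 \<simeq> 0")
    by (rule rcong_diff_eq[OF reduced_shuffle[of "[1]" "[4, 1]"]])
      (use p in \<open>simp_all add: evaluate\<close>)
  have r3: "hsum [2, 3, 1] + hsum [3, 1, 2] + hsum [3, 2, 1] \<simeq> 0"
      (is "?r3 \<simeq> 0")
    by (rule rcong_diff_eq[OF reduced_stuffle[of 2 "[3, 1]"]])
      (use p in \<open>simp_all add: evaluate\<close>)
  have r4: "hsum [3, 1, 2] + 4 * hsum [3, 2, 1] + 9 * hsum [4, 1, 1] \<simeq> 0"
      (is "?r4 \<simeq> 0")
    by (rule rcong_diff_eq[OF reduced_shuffle[of "[2]" "[3, 1]"]])
      (use p in \<open>simp_all add: evaluate\<close>)
  have r5: "- 7 / 2 * hsum [1, 4, 1] - 3 * hsum [2, 3, 1] - hsum [3, 2, 1] - 3 * hsum [4, 1, 1]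
      - 1 / 2 * bernoulli_num (p - 3) ^ 2 \<simeq> 0"
      (is "?r5 \<simeq> 0")
    by (rule rcong_diff_eq[OF reduced_shuffle[of "[1]" "[1, 3, 1]"]])
      (use p in \<open>simp_all add: evaluate field_simps power2_eq_square\<close>)
  have c411: "(1 / 2) * ?r1 + (- 5 / 6) * ?r2 + (- 1 / 6) * ?r3 + (1 / 6) * ?r4 + (- 1 / 3) * ?r5 \<simeq> 0"
    by (intro r1 r2 r3 r4 r5 zero_add zero_scale)
      (use p in \<open>simp_all add: pint_smooth\<close>)
  have c141: "(5 / 3) * ?r2 + (1 / 3) * ?r3 + (- 1 / 3) * ?r4 + (2 / 3) * ?r5 \<simeq> 0"
    by (intro r2 r3 r4 r5 zero_add zero_scale)
      (use p in \<open>simp_all add: pint_smooth\<close>)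
  have c231: "(- 7 / 4) * ?r2 + (- 1 / 4) * ?r3 + (1 / 4) * ?r4 + (- 1) * ?r5 \<simeq> 0"
    by (intro r2 r3 r4 r5 zero_add zero_scale)
      (use p in \<open>simp_all add: pint_smooth\<close>)
  show "hsum [4, 1, 1] \<simeq> - 1 / 6 * bernoulli_num (p - 3) ^ 2"
    by (rule rcong_diff_eq[OF c411]) (simp add: algebra_simps)
  show "hsum [1, 4, 1] \<simeq> 1 / 3 * bernoulli_num (p - 3) ^ 2"
    by (rule rcong_diff_eq[OF c141]) (simp add: algebra_simps)
  show "hsum [2, 3, 1] \<simeq> - 1 / 2 * bernoulli_num (p - 3) ^ 2"
    by (rule rcong_diff_eq[OF c231]) (simp add: algebra_simps)
qed

text \<open>
  The relation \<open>r21\<close> has depth five. The products in its normal form pair weights 3 and 6 or weights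
  5 and 4; the latter vanish by \<open>hsum_weight4\<close>, and the former produce the cube.
\<close>

lemma hsum_6111:
  assumes p: "p > 7"
  shows "hsum [6, 1, 1, 1] \<simeq> 1 / 54 * bernoulli_num (p - 3) ^ 3 + 1889 / 648 * bernoulli_num (p - 9)"
proof -
  note p = p_greater_10[OF p]
  have r1: "- hsum [1, 6, 1, 1] - 3 * hsum [6, 1, 1, 1] + 19 / 3 * bernoulli_num (p - 9) \<simeq> 0"
      (is "?r1 \<simeq> 0")
    by (rule rcong_diff_eq[OF reduced_stuffle[of 1 "[1, 1, 6]"]])
      (use p in \<open>simp_all add: evaluate\<close>)
  have r2: "- hsum [1, 4, 3, 1] - hsum [4, 1, 3, 1] - 2 * hsum [4, 3, 1, 1] + 6 * bernoulli_num (p - 9) \<simeq> 0"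
      (is "?r2 \<simeq> 0")
    by (rule rcong_diff_eq[OF reduced_stuffle[of 1 "[1, 3, 4]"]])
      (use p in \<open>simp_all add: evaluate\<close>)
  have r3: "hsum [2, 2, 4, 1] - hsum [4, 1, 2, 2] - hsum [4, 2, 1, 2] - hsum [4, 2, 2, 1]
      + 23 / 3 * bernoulli_num (p - 9) \<simeq> 0"
      (is "?r3 \<simeq> 0")
    by (rule rcong_diff_eq[OF reduced_stuffle[of 1 "[2, 2, 4]"]])
      (use p in \<open>simp_all add: evaluate\<close>)
  have r4: "hsum [1, 5, 2, 1] + hsum [5, 1, 2, 1] + 2 * hsum [5, 2, 1, 1] + 31 / 3 * bernoulli_num (p
      - 9) \<simeq> 0"
      (is "?r4 \<simeq> 0")
    by (rule rcong_diff_eq[OF reduced_stuffle[of 1 "[5, 2, 1]"]])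
      (use p in \<open>simp_all add: evaluate\<close>)
  have r5: "- hsum [2, 4, 2, 1] - hsum [4, 2, 1, 2] - 2 * hsum [4, 2, 2, 1] + 73 / 3 * bernoulli_num (p
      - 9) \<simeq> 0"
      (is "?r5 \<simeq> 0")
    by (rule rcong_diff_eq[OF reduced_stuffle[of 2 "[1, 2, 4]"]])
      (use p in \<open>simp_all add: evaluate\<close>)
  have r6: "hsum [2, 3, 2, 2] + 3 * hsum [3, 2, 2, 2] + 82 / 3 * bernoulli_num (p - 9) \<simeq> 0"
      (is "?r6 \<simeq> 0")
    by (rule rcong_diff_eq[OF reduced_stuffle[of 2 "[3, 2, 2]"]])
      (use p in \<open>simp_all add: evaluate\<close>)
  have r7: "hsum [2, 3, 3, 1] + hsum [3, 2, 3, 1] + hsum [3, 3, 1, 2] + hsum [3, 3, 2, 1]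
      + 32 / 3 * bernoulli_num (p - 9) \<simeq> 0"
      (is "?r7 \<simeq> 0")
    by (rule rcong_diff_eq[OF reduced_stuffle[of 2 "[3, 3, 1]"]])
      (use p in \<open>simp_all add: evaluate\<close>)
  have r8: "hsum [2, 5, 1, 1] + hsum [5, 1, 1, 2] + hsum [5, 1, 2, 1] + hsum [5, 2, 1, 1]
      + 31 / 3 * bernoulli_num (p - 9) \<simeq> 0"
      (is "?r8 \<simeq> 0")
    by (rule rcong_diff_eq[OF reduced_stuffle[of 2 "[5, 1, 1]"]])
      (use p in \<open>simp_all add: evaluate\<close>)
  have r9: "- hsum [3, 2, 1, 3] - hsum [3, 2, 3, 1] - 2 * hsum [3, 3, 2, 1] - 32 / 3 * bernoulli_num (p
      - 9) \<simeq> 0"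
      (is "?r9 \<simeq> 0")
    by (rule rcong_diff_eq[OF reduced_stuffle[of 3 "[1, 2, 3]"]])
      (use p in \<open>simp_all add: evaluate\<close>)
  have r10: "- 2 * hsum [1, 4, 3, 1] - hsum [2, 3, 3, 1] - hsum [3, 2, 3, 1] - 2 * hsum [4, 1, 3, 1]
      - hsum [4, 2, 2, 1] - 3 * hsum [4, 3, 1, 1] \<simeq> 0"
      (is "?r10 \<simeq> 0")
    by (rule rcong_diff_eq[OF reduced_shuffle[of "[1]" "[1, 3, 4]"]])
      (use p in \<open>simp_all add: evaluate\<close>)
  have r11: "2 * hsum [1, 4, 3, 1] - hsum [2, 2, 4, 1] - 2 * hsum [3, 1, 4, 1] - hsum [3, 2, 3, 1]
      - hsum [3, 3, 2, 1] - 3 * hsum [3, 4, 1, 1] \<simeq> 0"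
      (is "?r11 \<simeq> 0")
    by (rule rcong_diff_eq[OF reduced_shuffle[of "[1]" "[1, 4, 3]"]])
      (use p in \<open>simp_all add: evaluate\<close>)
  have r12: "- 2 * hsum [2, 2, 4, 1] + hsum [2, 3, 2, 2] + hsum [3, 2, 2, 2] + 2 * hsum [4, 1, 2, 2]
      + 2 * hsum [4, 2, 1, 2] + 2 * hsum [4, 2, 2, 1] \<simeq> 0"
      (is "?r12 \<simeq> 0")
    by (rule rcong_diff_eq[OF reduced_shuffle[of "[1]" "[4, 2, 2]"]])
      (use p in \<open>simp_all add: evaluate\<close>)
  have r13: "2 * hsum [1, 5, 2, 1] + hsum [2, 4, 2, 1] + hsum [3, 3, 2, 1] + hsum [4, 2, 2, 1]
      + 2 * hsum [5, 1, 2, 1] + 3 * hsum [5, 2, 1, 1] \<simeq> 0"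
      (is "?r13 \<simeq> 0")
    by (rule rcong_diff_eq[OF reduced_shuffle[of "[1]" "[5, 2, 1]"]])
      (use p in \<open>simp_all add: evaluate\<close>)
  have r14: "2 * hsum [1, 6, 1, 1] + hsum [2, 5, 1, 1] + hsum [3, 4, 1, 1] + hsum [4, 3, 1, 1]
      + hsum [5, 2, 1, 1] + 4 * hsum [6, 1, 1, 1] \<simeq> 0"
      (is "?r14 \<simeq> 0")
    by (rule rcong_diff_eq[OF reduced_shuffle[of "[1]" "[6, 1, 1]"]])
      (use p in \<open>simp_all add: evaluate\<close>)
  have r15: "5 * hsum [3, 2, 2, 2] + 4 * hsum [3, 2, 3, 1] + 4 * hsum [3, 3, 1, 2] + 4 * hsum [3, 3, 2, 1]
      + 6 * hsum [4, 1, 2, 2] + 6 * hsum [4, 2, 1, 2] + 6 * hsum [4, 2, 2, 1] \<simeq> 0"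
      (is "?r15 \<simeq> 0")
    by (rule rcong_diff_eq[OF reduced_shuffle[of "[2]" "[3, 2, 2]"]])
      (use p in \<open>simp_all add: evaluate\<close>)
  have r16: "3 * hsum [3, 2, 3, 1] + hsum [3, 3, 1, 2] + 4 * hsum [3, 3, 2, 1] + 9 * hsum [3, 4, 1, 1]
      + 6 * hsum [4, 1, 3, 1] + 3 * hsum [4, 2, 2, 1] + 9 * hsum [4, 3, 1, 1] \<simeq> 0"
      (is "?r16 \<simeq> 0")
    by (rule rcong_diff_eq[OF reduced_shuffle[of "[2]" "[3, 3, 1]"]])
      (use p in \<open>simp_all add: evaluate\<close>)
  have r17: "2 * hsum [3, 3, 1, 2] + 2 * hsum [4, 1, 2, 2] + 4 * hsum [4, 1, 3, 1] + 5 * hsum [4, 2, 1, 2]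
      + 2 * hsum [4, 2, 2, 1] + 12 * hsum [5, 1, 1, 2] + 8 * hsum [5, 1, 2, 1] \<simeq> 0"
      (is "?r17 \<simeq> 0")
    by (rule rcong_diff_eq[OF reduced_shuffle[of "[2]" "[4, 1, 2]"]])
      (use p in \<open>simp_all add: evaluate\<close>)
  have r18: "2 * hsum [3, 3, 2, 1] + hsum [4, 2, 1, 2] + 6 * hsum [4, 2, 2, 1] + 6 * hsum [4, 3, 1, 1]
      + 8 * hsum [5, 1, 2, 1] + 12 * hsum [5, 2, 1, 1] \<simeq> 0"
      (is "?r18 \<simeq> 0")
    by (rule rcong_diff_eq[OF reduced_shuffle[of "[2]" "[4, 2, 1]"]])
      (use p in \<open>simp_all add: evaluate\<close>)
  have r19: "2 * hsum [3, 4, 1, 1] + 3 * hsum [4, 3, 1, 1] + hsum [5, 1, 1, 2] + 2 * hsum [5, 1, 2, 1]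
      + 7 * hsum [5, 2, 1, 1] + 20 * hsum [6, 1, 1, 1] \<simeq> 0"
      (is "?r19 \<simeq> 0")
    by (rule rcong_diff_eq[OF reduced_shuffle[of "[2]" "[5, 1, 1]"]])
      (use p in \<open>simp_all add: evaluate\<close>)
  have r20: "hsum [3, 2, 1, 3] + hsum [3, 2, 2, 2] + 2 * hsum [3, 2, 3, 1] + 2 * hsum [3, 3, 1, 2]
      + 7 * hsum [3, 3, 2, 1] + 9 * hsum [3, 4, 1, 1] + 3 * hsum [4, 2, 1, 2]
      + 12 * hsum [4, 2, 2, 1] + 18 * hsum [4, 3, 1, 1] + 12 * hsum [5, 1, 2, 1]
      + 18 * hsum [5, 2, 1, 1] \<simeq> 0"
      (is "?r20 \<simeq> 0")
    by (rule rcong_diff_eq[OF reduced_shuffle[of "[3]" "[3, 2, 1]"]])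
      (use p in \<open>simp_all add: evaluate\<close>)
  have r21: "2 * hsum [1, 4, 3, 1] + 3 * hsum [1, 5, 2, 1] - 3 / 2 * hsum [2, 2, 4, 1]
      + 3 / 2 * hsum [2, 4, 2, 1] - hsum [3, 1, 4, 1] - 1 / 2 * hsum [3, 2, 3, 1]
      - 3 / 2 * hsum [3, 4, 1, 1] + 1 / 2 * hsum [4, 2, 2, 1] + hsum [5, 1, 2, 1]
      + 3 / 2 * hsum [5, 2, 1, 1] - bernoulli_num (p - 3) * hsum [1, 4, 1]
      - 1 / 2 * bernoulli_num (p - 3) * hsum [2, 3, 1] - 3 / 2 * bernoulli_num (p
      - 3) * hsum [4, 1, 1] + bernoulli_num (p - 5) * hsum [1, 2, 1] + 3 / 2 * bernoulli_num (p
      - 5) * hsum [2, 1, 1] \<simeq> 0"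
      (is "?r21 \<simeq> 0")
    by (rule rcong_diff_eq[OF reduced_shuffle[of "[1]" "[1, 2, 4, 1]"]])
      (use p in \<open>simp_all add: evaluate field_simps power2_eq_square\<close>)
  have "(- 2 / 3) * ?r1 + (- 1 / 6) * ?r2 + (- 53 / 432) * ?r3 + (1 / 6) * ?r4 + (- 1 / 12) * ?r5
      + (5 / 864) * ?r6 + (1 / 36) * ?r7 + (1 / 3) * ?r8 + (7 / 216) * ?r9 + (1 / 36) * ?r10
      + (1 / 18) * ?r11 + (- 5 / 864) * ?r12 + (1 / 12) * ?r13 + (- 1 / 3) * ?r14
      + (- 19 / 2160) * ?r15 + (1 / 1080) * ?r16 + (- 7 / 240) * ?r17 + (- 67 / 720) * ?r18
      + (1 / 60) * ?r19 + (7 / 216) * ?r20 + (- 1 / 9) * ?r21 \<simeq> 0"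
    by (intro r1 r2 r3 r4 r5 r6 r7 r8 r9 r10 r11 r12
          r13 r14 r15 r16 r17 r18 r19 r20 r21 zero_add zero_scale)
      (use p in \<open>simp_all add: pint_smooth\<close>)
  then have "hsum [6, 1, 1, 1] \<simeq> 1889 / 648 * bernoulli_num (p - 9)
      + bernoulli_num (p - 5) * (1 / 6 * hsum [2, 1, 1] + 1 / 9 * hsum [1, 2, 1])
      - bernoulli_num (p - 3) * (1 / 9 * hsum [1, 4, 1] + 1 / 18 * hsum [2, 3, 1] + 1 / 6 * hsum [4, 1, 1])"
    by (rule rcong_diff_eq) (simp add: algebra_simps)
  also have "\<dots> \<simeq> 1889 / 648 * bernoulli_num (p - 9)
      + bernoulli_num (p - 5) * (1 / 6 * 0 + 1 / 9 * 0)
      - bernoulli_num (p - 3) * (1 / 9 * (1 / 3 * bernoulli_num (p - 3) ^ 2)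
          + 1 / 18 * (- 1 / 2 * bernoulli_num (p - 3) ^ 2) + 1 / 6 * (- 1 / 6 * bernoulli_num (p - 3) ^ 2))"
    by (intro rcong_add rcong_diff rcong_scale rcong_refl hsum_weight4 hsum_weight6)
       (use p in \<open>simp_all add: pint_smooth bernoulli_pint\<close>)
  also have "\<dots> = 1 / 54 * bernoulli_num (p - 3) ^ 3 + 1889 / 648 * bernoulli_num (p - 9)"
    by (simp add: power2_eq_square power3_eq_cube algebra_simps)
  finally show ?thesis .
qed

end

theorem corollary4p1:
  fixes p :: nat
  assumes "prime p" and "p > 7"
  shows "rat_cong (mult_harm_star (p - 1) [1, 1, 1, 4]) (mult_harm_star (p - 1) [1, 2, 2, 2]) p
       \<and> rat_cong (mult_harm_star (p - 1) [1, 2, 2, 2]) (27 / 16 * bernoulli_num (p - 7)) p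
       \<and> rat_cong (mult_harm_star (p - 1) [1, 1, 1, 6])
           (1 / 54 * bernoulli_num (p - 3) ^ 3 + 1889 / 648 * bernoulli_num (p - 9)) p"
proof -
  interpret prime_modulus p by unfold_locales (rule assms)
  note p = p_greater_10[OF assms(2)]
  have star: "mult_harm_star (p - 1) s = ssum (rev s)" for s
    by (simp add: mult_harm_star_eq_mhs_star ssum_def)
  \<comment> \<open>In depth four and odd weight the contributions of all proper coarsenings to a star sum cancel.\<close>
  have "ssum [4, 1, 1, 1] \<simeq> hsum [4, 1, 1, 1]"
    by (rule rcong_diff_eq[OF ssum_reduced[of "[4, 1, 1, 1]"]])
      (use p in \<open>simp_all add: evaluate\<close>)
  also have "\<dots> \<simeq> 27 / 16 * bernoulli_num (p - 7)" by (rule hsum_4111[OF assms(2)])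
  finally have 1: "mult_harm_star (p - 1) [1, 1, 1, 4] \<simeq> 27 / 16 * bernoulli_num (p - 7)"
    unfolding star by simp
  have "ssum [2, 2, 2, 1] \<simeq> hsum [2, 2, 2, 1]"
    by (rule rcong_diff_eq[OF ssum_reduced[of "[2, 2, 2, 1]"]])
      (use p in \<open>simp_all add: evaluate\<close>)
  also have "\<dots> \<simeq> 27 / 16 * bernoulli_num (p - 7)" by (rule hsum_2221[OF assms(2)])
  finally have 2: "mult_harm_star (p - 1) [1, 2, 2, 2] \<simeq> 27 / 16 * bernoulli_num (p - 7)"
    unfolding star by simp
  have "ssum [6, 1, 1, 1] \<simeq> hsum [6, 1, 1, 1]"
    by (rule rcong_diff_eq[OF ssum_reduced[of "[6, 1, 1, 1]"]])
      (use p in \<open>simp_all add: evaluate\<close>)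
  also have "\<dots> \<simeq> 1 / 54 * bernoulli_num (p - 3) ^ 3 + 1889 / 648 * bernoulli_num (p - 9)"
    by (rule hsum_6111[OF assms(2)])
  finally have 3: "mult_harm_star (p - 1) [1, 1, 1, 6] \<simeq> 1 / 54 * bernoulli_num (p - 3) ^ 3 + 1889 / 648 * bernoulli_num (p - 9)"
    unfolding star by simp
  show ?thesis
    using rat_congI[OF rcong_trans[OF 1 rcong_sym[OF 2]]] rat_congI[OF 2] rat_congI[OF 3] by blast
qed

end
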